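(* Let $k\geq 1$ be an integer and let $m(x)=\sin(2k\pi x)$ for $x\in[0,1]$. For $\lambda\in\mathbb{R}$ and each integer $n\geq 1$, let $\Sigma_n(\lambda)$ denote the $n$-th eigenvalue of the Dirichlet problem $-\varphi''-\lambda m(x)\varphi=\sigma\varphi$ in $(0,1)$, $\varphi(0)=\varphi(1)=0$. Then $$\frac{d^2\Sigma_n}{d\lambda^2}(0)>0\quad\text{for all integers } n\geq k+1.$$ Therefore, since $\frac{d\Sigma_n}{d\lambda}(0)=0$, for every $n\geq k+1$ the point $\lambda=0$ is a local minimum of the function $\lambda\mapsto\Sigma_n(\lambda)$ and, in particular, $\Sigma_n$ is not a concave function of $\lambda\in\mathbb{R}$.
   Context: For a continuous function $m$ on $[0,1]$ and $\lambda\in\mathbb{R}$, the eigenvalues $\sigma$ of the Sturm--Liouville problem $-\varphi''-\lambda m(x)\varphi=\sigma\varphi$ in $(0,1)$, $\varphi(0)=\varphi(1)=0$, form a strictly increasing sequence of simple eigenvalues $\Sigma_1(\lambda)<\Sigma_2(\lambda)<\cdots$; $\Sigma_n(\lambda)$ is the $n$-th one, characterized as the unique eigenvalue having an eigenfunction with exactly $n-1$ zeros in the open interval $(0,1)$. For each $n$, the function $\lambda\mapsto\Sigma_n(\lambda)$ is real analytic on $\mathbb{R}$, so its derivatives in $\lambda$ are well defined. *)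

theory Defs
  imports "HOL-Analysis.Analysis"
begin

text \<open>
  Classical solutions are meant: the equation holds pointwise in the open interval and the
  boundary values are attained continuously. For continuous \<open>m\<close> the equation itself makes
  \<open>\<phi>''\<close> continuous in the open interval.
\<close>

definition dirichlet_eigenfunction ::
  "(real \<Rightarrow> real) \<Rightarrow> real \<Rightarrow> real \<Rightarrow> (real \<Rightarrow> real) \<Rightarrow> bool"
where
  "dirichlet_eigenfunction m \<mu> \<sigma> \<phi> \<longleftrightarrow>
     continuous_on {0..1} \<phi> \<and> \<phi> 0 = 0 \<and> \<phi> 1 = 0 \<and> (\<exists>x\<in>{0<..<1}. \<phi> x \<noteq> 0) \<and>
     (\<exists>\<phi>' \<phi>''. \<forall>x\<in>{0<..<1}.
        (\<phi> has_real_derivative \<phi>' x) (at x) \<and>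
        (\<phi>' has_real_derivative \<phi>'' x) (at x) \<and>
        - \<phi>'' x - \<mu> * m x * \<phi> x = \<sigma> * \<phi> x)"

definition dirichlet_eigenvalue :: "(real \<Rightarrow> real) \<Rightarrow> real \<Rightarrow> real \<Rightarrow> bool" where
  "dirichlet_eigenvalue m \<mu> \<sigma> \<longleftrightarrow> (\<exists>\<phi>. dirichlet_eigenfunction m \<mu> \<sigma> \<phi>)"

text \<open>
  The eigenvalues form a strictly increasing sequence of simple eigenvalues, so the \<open>n\<close>-th one
  (\<open>n \<ge> 1\<close>) is the eigenvalue with exactly \<open>n - 1\<close> eigenvalues below it. Finiteness is required
  separately because \<open>card\<close> of an infinite set is \<open>0\<close>.
\<close>

definition nth_dirichlet_eigenvalue :: "(real \<Rightarrow> real) \<Rightarrow> nat \<Rightarrow> real \<Rightarrow> real" where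
  "nth_dirichlet_eigenvalue m n \<mu> =
     (THE \<sigma>. dirichlet_eigenvalue m \<mu> \<sigma> \<and>
        finite {\<tau>. dirichlet_eigenvalue m \<mu> \<tau> \<and> \<tau> < \<sigma>} \<and>
        card {\<tau>. dirichlet_eigenvalue m \<mu> \<tau> \<and> \<tau> < \<sigma>} + 1 = n)"

end

theory Submission
  imports Defs
begin

text \<open>
  Let \<open>Y p\<close>, \<open>p = (\<sigma>, \<mu>)\<close>, be the solution of \<open>y'' = - (\<sigma> + \<mu> m) y\<close>, \<open>y(0) = 0\<close>, \<open>y'(0) = 1\<close>, so that
  eigenvalues are the zeros of \<open>\<sigma> \<mapsto> Y p 1\<close>. Green's identity for two eigenfunctions gives
  \<open>(\<sigma> - \<sigma>') G p p' = - (\<mu> - \<mu>') H p p'\<close> with \<open>G p p' = \<integral> Y p Y p'\<close> and \<open>H p p' = \<integral> m Y p Y p'\<close>.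
  As \<open>Y\<close> is continuous and \<open>G p p > 0\<close>, this one identity yields, near a point with \<open>\<mu> = 0\<close>, uniqueness
  and Lipschitz continuity of the eigenvalue branch and its derivative \<open>- H p p / G p p\<close>.
  A second use of Green's identity, against the solution \<open>u\<close> of
  \<open>- u'' - n\<^sup>2 \<pi>\<^sup>2 u = m Y p0\<close>, expands \<open>H p p0\<close> to first order in \<open>\<mu>\<close> and gives
  \<open>\<Sigma>''(0) = - 2 (\<integral> m u Y p0) / G p0 p0\<close>; for \<open>m = sin (2 k \<pi> x)\<close> the function \<open>u\<close> is a
  combination of three cosines and the integral is negative when \<open>n > k\<close>.
\<close>

section \<open>Linear second-order equations\<close>

text \<open>The function \<open>E x * exp (- C * (x - a)) - D * (x - a)\<close> is nonincreasing:
  its derivative is at most \<open>D * exp (- C * (x - a)) - D\<close>, and the exponential is at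
  most 1.\<close>

lemma gronwall_linear:
  fixes E E' :: "real \<Rightarrow> real"
  assumes ab: "a \<le> b" and cont: "continuous_on {a..b} E"
    and der: "\<And>x. a < x \<Longrightarrow> x < b \<Longrightarrow> (E has_real_derivative E' x) (at x)"
    and le: "\<And>x. a < x \<Longrightarrow> x < b \<Longrightarrow> E' x \<le> C * E x + D"
    and C: "C \<ge> 0" and D: "D \<ge> 0"
  shows "E b \<le> (E a + D * (b - a)) * exp (C * (b - a))"
proof -
  let ?g = "\<lambda>x. E x * exp (- C * (x - a)) - D * (x - a)"
  have "?g b \<le> ?g a"
  proof (rule DERIV_nonpos_imp_decreasing_open[OF ab])
    fix x assume x: "a < x" "x < b"
    have "(?g has_real_derivative (E' x - C * E x) * exp (- C * (x - a)) - D) (at x)"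
      by (auto intro!: derivative_eq_intros der x simp: algebra_simps)
    moreover have "(E' x - C * E x) * exp (- C * (x - a)) \<le> D * 1"
    proof (rule order_trans[OF mult_right_mono mult_left_mono])
      show "E' x - C * E x \<le> D" using le[OF x] by simp
    qed (use x C D in auto)
    ultimately show "\<exists>y. (?g has_real_derivative y) (at x) \<and> y \<le> 0" by fastforce
  qed (intro continuous_intros cont)
  then have "E b * exp (- C * (b - a)) \<le> E a + D * (b - a)" by simp
  then have "E b * exp (- C * (b - a)) * exp (C * (b - a)) \<le> (E a + D * (b - a)) * exp (C * (b - a))"
    by (rule mult_right_mono) simp
  then show ?thesis by (simp add: mult.assoc flip: exp_add)
qed

text \<open>To the right of \<open>z\<close> this is the forward inequality, to the left it is the
  forward inequality for \<open>t \<mapsto> E (- t)\<close>. Only interior points occur, which suits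
  classical eigenfunctions, whose derivative is given in the open interval alone.\<close>

lemma gronwall_two_sided:
  fixes E E' :: "real \<Rightarrow> real"
  assumes der: "\<And>x. x \<in> {a<..<b} \<Longrightarrow> (E has_real_derivative E' x) (at x)"
    and le: "\<And>x. x \<in> {a<..<b} \<Longrightarrow> \<bar>E' x\<bar> \<le> C * E x"
    and C: "C \<ge> 0" and xz: "x \<in> {a<..<b}" "z \<in> {a<..<b}"
  shows "E x \<le> E z * exp (C * \<bar>x - z\<bar>)"
proof (cases "z \<le> x")
  case True
  have "E x \<le> (E z + 0 * (x - z)) * exp (C * (x - z))"
  proof (rule gronwall_linear[OF True _ _ _ C, where E' = E'])
    show "continuous_on {z..x} E"
      using xz by (intro continuous_at_imp_continuous_on ballI DERIV_isCont[OF der]) auto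
  next
    fix t assume "z < t" "t < x"
    then show "(E has_real_derivative E' t) (at t)" "E' t \<le> C * E t + 0"
      using der[of t] le[of t] xz by auto
  qed simp
  then show ?thesis using True by simp
next
  case False
  have der': "((\<lambda>t. E (- t)) has_real_derivative - E' (- t)) (at t)" if "- t \<in> {a<..<b}" for t
    using DERIV_chain2[where f = E and g = uminus, OF der[OF that] DERIV_minus[OF DERIV_ident]] by simp
  have "E (- (- x)) \<le> (E (- (- z)) + 0 * (- x - - z)) * exp (C * (- x - - z))"
  proof (rule gronwall_linear[where E' = "\<lambda>t. - E' (- t)", OF _ _ _ _ C])
    show "continuous_on {- z..- x} (\<lambda>t. E (- t))"
      using xz by (intro continuous_at_imp_continuous_on ballI DERIV_isCont[OF der']) auto
  next
    fix t assume "- z < t" "t < - x"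
    then show "((\<lambda>t. E (- t)) has_real_derivative - E' (- t)) (at t)" "- E' (- t) \<le> C * E (- t) + 0"
      using der'[of t] le[of "-t"] xz by auto
  qed (use False in auto)
  then show ?thesis using False by simp
qed

section \<open>Existence for the initial value problem by Picard iteration\<close>

text \<open>The equation \<open>y'' = - q y\<close> as a first-order system. One-sided derivatives
  at the endpoints make \<open>y\<close> and \<open>y'\<close> continuous on the closed interval, so
  that initial data and boundary terms make sense.\<close>

definition ode_solution :: "(real \<Rightarrow> real) \<Rightarrow> (real \<Rightarrow> real) \<Rightarrow> (real \<Rightarrow> real) \<Rightarrow> bool" where
  "ode_solution q y y' \<longleftrightarrow> (\<forall>x\<in>{0..1}.
     (y has_real_derivative y' x) (at x within {0..1}) \<and>
     (y' has_real_derivative - q x * y x) (at x within {0..1}))"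

lemma ode_solutionD:
  assumes "ode_solution q y y'"
  shows "x \<in> {0..1} \<Longrightarrow> (y has_real_derivative y' x) (at x within {0..1})"
    and "x \<in> {0..1} \<Longrightarrow> (y' has_real_derivative - q x * y x) (at x within {0..1})"
    and "x \<in> {0<..<1} \<Longrightarrow> (y has_real_derivative y' x) (at x)"
    and "x \<in> {0<..<1} \<Longrightarrow> (y' has_real_derivative - q x * y x) (at x)"
    and "continuous_on {0..1} y" and "continuous_on {0..1} y'"
proof -
  show 1: "x \<in> {0..1} \<Longrightarrow> (y has_real_derivative y' x) (at x within {0..1})"
    and 2: "x \<in> {0..1} \<Longrightarrow> (y' has_real_derivative - q x * y x) (at x within {0..1})" for x
    using assms by (auto simp: ode_solution_def)
  show "continuous_on {0..1} y" "continuous_on {0..1} y'"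
    by (rule DERIV_continuous_on, erule 1) (rule DERIV_continuous_on, erule 2)
  show "x \<in> {0<..<1} \<Longrightarrow> (y has_real_derivative y' x) (at x)"
    using 1[of x] by (auto simp: at_within_Icc_at)
  show "x \<in> {0<..<1} \<Longrightarrow> (y' has_real_derivative - q x * y x) (at x)"
    using 2[of x] by (auto simp: at_within_Icc_at)
qed

text \<open>Picard iterates of the first-order system, with the two components interleaved:
  the even ones sum up to \<open>y'\<close>, the odd ones to \<open>y\<close>.\<close>

primrec picard :: "(real \<Rightarrow> real) \<Rightarrow> nat \<Rightarrow> real \<Rightarrow> real" where
  "picard q 0 = (\<lambda>x. 1)"
| "picard q (Suc j) = (\<lambda>x. integral {0..x} (\<lambda>t. (if even j then 1 else - q t) * picard q j t))"

lemma picard_deriv: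
  assumes q: "continuous_on {0..1} q" and x: "x \<in> {0..1}"
  shows "(picard q (Suc j) has_real_derivative (if even j then 1 else - q x) * picard q j x)
           (at x within {0..1})"
proof -
  have "continuous_on {0..1} (\<lambda>t. (if even j then 1 else - q t) * picard q j t)" for j
  proof (induction j)
    case 0 then show ?case by simp
  next
    case (Suc j)
    have "continuous_on {0..1} (picard q (Suc j))"
      by (rule DERIV_continuous_on, simp only: picard.simps)
         (rule integral_has_real_derivative[OF Suc])
    moreover have "continuous_on {0..1} (\<lambda>t. if even (Suc j) then 1 else - q t)"
      using q by (cases "even (Suc j)") (auto intro!: continuous_intros simp del: even_Suc)
    ultimately show ?case by (intro continuous_on_mult)
  qed
  from integral_has_real_derivative[OF this x] show ?thesis by simp
qed

lemma picard_zero: "picard q (Suc j) 0 = 0"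
  by simp

text \<open>Each iteration multiplies by a factor of size at most \<open>Q\<close> and integrates;
  \<open>Q \<ge> 1\<close> also covers the factor 1 of the even steps. Integrating
  \<open>Q * (Q * t) ^ j / fact j\<close> gives the next bound exactly.\<close>

lemma picard_bound:
  assumes q: "continuous_on {0..1} q" and Q: "\<And>x. x \<in> {0..1} \<Longrightarrow> \<bar>q x\<bar> \<le> Q" and Q1: "Q \<ge> 1"
  shows "x \<in> {0..1} \<Longrightarrow> \<bar>picard q j x\<bar> \<le> (Q * x) ^ j / fact j"
proof (induction j arbitrary: x)
  case 0 then show ?case by simp
next
  case (Suc j)
  let ?f = "\<lambda>t. (if even j then 1 else - q t) * picard q j t"
  have "(?f has_integral picard q (Suc j) x - picard q (Suc j) 0) {0..x}"
  proof (rule fundamental_theorem_of_calculus)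
    fix t assume "t \<in> {0..x}"
    then show "(picard q (Suc j) has_vector_derivative ?f t) (at t within {0..x})"
      using picard_deriv[OF q, of t j] Suc.prems
      unfolding has_real_derivative_iff_has_vector_derivative
      by (auto intro: has_vector_derivative_within_subset)
  qed (use Suc.prems in auto)
  then have i1: "(?f has_integral picard q (Suc j) x) {0..x}" unfolding picard_zero by simp
  have "((\<lambda>t. Q * ((Q * t) ^ j / fact j)) has_integral
      (Q * x) ^ Suc j / fact (Suc j) - (Q * 0) ^ Suc j / fact (Suc j)) {0..x}"
  proof (rule fundamental_theorem_of_calculus)
    fix t :: real
    have "((\<lambda>t. (Q * t) ^ Suc j / fact (Suc j)) has_real_derivative
        (of_nat (Suc j) * (Q * t) ^ j * Q) / fact (Suc j)) (at t within {0..x})"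
      by (rule derivative_eq_intros refl | simp)+
    also have "(of_nat (Suc j) * (Q * t) ^ j * Q) / fact (Suc j) = Q * ((Q * t) ^ j / fact j)"
      unfolding fact_Suc of_nat_mult by (simp add: field_simps del: of_nat_Suc)
    finally show "((\<lambda>t. (Q * t) ^ Suc j / fact (Suc j)) has_vector_derivative Q * ((Q * t) ^ j / fact j))
        (at t within {0..x})"
      by (simp only: has_real_derivative_iff_has_vector_derivative)
  qed (use Suc.prems in auto)
  then have i2: "((\<lambda>t. Q * ((Q * t) ^ j / fact j)) has_integral (Q * x) ^ Suc j / fact (Suc j)) {0..x}"
    by simp
  have "norm (integral {0..x} ?f) \<le> integral {0..x} (\<lambda>t. Q * ((Q * t) ^ j / fact j))"
  proof (rule integral_norm_bound_integral)
    fix t assume "t \<in> {0..x}"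
    then have t: "t \<in> {0..1}" using Suc.prems by auto
    have "\<bar>if even j then 1 else - q t\<bar> \<le> Q" using Q[OF t] Q1 by auto
    then show "norm (?f t) \<le> Q * ((Q * t) ^ j / fact j)"
      unfolding real_norm_def abs_mult using Suc.IH[OF t] Q1 by (intro mult_mono) auto
  qed (use i1 i2 in auto)
  then show ?case using integral_unique[OF i1] integral_unique[OF i2] by (simp del: picard.simps power_Suc fact_Suc)
qed

lemma ode_solution_exists:
  assumes q: "continuous_on {0..1} q"
  shows "\<exists>y y'. ode_solution q y y' \<and> y 0 = 0 \<and> y' 0 = 1"
proof -
  obtain Q0 where Q0: "\<And>x. x \<in> {0..1} \<Longrightarrow> \<bar>q x\<bar> \<le> Q0"
    using compact_imp_bounded[OF compact_continuous_image[OF q compact_Icc]]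
    unfolding bounded_iff by (metis imageI real_norm_def)
  define Q where "Q = max 1 Q0"
  have Q: "\<And>x. x \<in> {0..1} \<Longrightarrow> \<bar>q x\<bar> \<le> Q" and Q1: "Q \<ge> 1"
    using Q0 by (fastforce simp: Q_def)+
  have b: "\<bar>picard q j x\<bar> \<le> Q ^ j / fact j" if x: "x \<in> {0..1}" for j x
  proof -
    have "(Q * x) ^ j \<le> Q ^ j"
      using x Q1 by (intro power_mono) (auto simp: mult_left_le)
    then have "(Q * x) ^ j / fact j \<le> Q ^ j / fact j" by (rule divide_right_mono) simp
    with picard_bound[OF q _ Q1 x, of j] Q show ?thesis by fastforce
  qed
  have sm: "summable (\<lambda>j. Q ^ j / fact j)"
    using summable_exp[of Q] by (simp add: field_simps)
  have sm1: "summable (\<lambda>i. Q ^ (2 * i + 1) / fact (2 * i + 1))"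
    and sm0: "summable (\<lambda>i. Q ^ (2 * i) / fact (2 * i))"
    using summable_reindex[OF sm, of "\<lambda>i. 2 * i + 1"] summable_reindex[OF sm, of "\<lambda>i. 2 * i"] Q1
    by (auto simp: inj_def o_def)
  \<comment> \<open>Termwise differentiation is applied twice: the derivatives of the odd iterates
    are the even ones, summing to \<open>z\<close>, and those of the even iterates from index 2 on
    are \<open>- q\<close> times the odd ones. The exponential series dominates both.\<close>
  define z where "z x = (\<Sum>i. picard q (2 * i) x)" for x
  have ul0: "uniform_limit {0..1} (\<lambda>n x. \<Sum>i<n. picard q (2 * i) x) z sequentially"
    unfolding z_def by (rule Weierstrass_m_test[OF _ sm0]) (use b in auto)
  have s1: "summable (\<lambda>i. picard q (2 * i + 1) x)" if "x \<in> {0..1}" for x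
    by (rule summable_comparison_test'[OF sm1]) (use b[OF that] in \<open>simp only: real_norm_def\<close>)
  have ul1: "uniform_limit {0..1} (\<lambda>n x. \<Sum>i<n. - q x * picard q (2 * i + 1) x)
      (\<lambda>x. \<Sum>i. - q x * picard q (2 * i + 1) x) sequentially"
  proof (rule Weierstrass_m_test[OF _ summable_mult[OF sm1, of Q]])
    fix i x assume x: "x \<in> {0..1::real}"
    show "norm (- q x * picard q (2 * i + 1) x) \<le> Q * (Q ^ (2 * i + 1) / fact (2 * i + 1))"
      unfolding real_norm_def abs_mult abs_minus using Q[OF x] b[OF x, of "2 * i + 1"] Q1
      by (intro mult_mono) (assumption | linarith)+
  qed
  have "\<exists>g. \<forall>x\<in>{0..1}. (\<lambda>i. picard q (2 * i + 1) x) sums g x \<and>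
      (g has_real_derivative z x) (at x within {0..1})"
    by (rule has_field_derivative_series[OF _ _ ul0, where ?x0.0 = 0])
       (use picard_deriv[OF q, of _ "2 * _"] in \<open>auto simp del: picard.simps simp: picard_zero\<close>)
  then obtain y2 where y2: "\<And>x. x \<in> {0..1} \<Longrightarrow> (\<lambda>i. picard q (2 * i + 1) x) sums y2 x"
     "\<And>x. x \<in> {0..1} \<Longrightarrow> (y2 has_real_derivative z x) (at x within {0..1})"
    by blast
  have "\<exists>g. \<forall>x\<in>{0..1}. (\<lambda>i. picard q (2 * i + 2) x) sums g x \<and>
      (g has_real_derivative (\<Sum>i. - q x * picard q (2 * i + 1) x)) (at x within {0..1})"
    by (rule has_field_derivative_series[OF _ _ ul1, where ?x0.0 = 0])
       (use picard_deriv[OF q, of _ "2 * _ + 1"] in \<open>auto simp del: picard.simps simp: picard_zero\<close>)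
  then obtain z2 where z2: "\<And>x. x \<in> {0..1} \<Longrightarrow> (\<lambda>i. picard q (2 * i + 2) x) sums z2 x"
     "\<And>x. x \<in> {0..1} \<Longrightarrow> (z2 has_real_derivative (\<Sum>i. - q x * picard q (2 * i + 1) x)) (at x within {0..1})"
    by blast
  \<comment> \<open>\<open>z2\<close> starts at index 2; the omitted iterate of index 0 is the
    constant 1, which is the initial value of \<open>y'\<close>.\<close>
  have z: "z x = z2 x + 1" if "x \<in> {0..1}" for x
  proof -
    have "(\<lambda>i. picard q (2 * Suc i) x) sums z2 x" using z2(1)[OF that] by simp
    from sums_Suc[OF this] show ?thesis by (simp add: z_def sums_iff)
  qed
  have "ode_solution q y2 (\<lambda>x. z2 x + 1)"
    unfolding ode_solution_def
  proof (intro ballI conjI)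
    fix x assume x: "x \<in> {0..1::real}"
    show "(y2 has_real_derivative z2 x + 1) (at x within {0..1})" using y2(2)[OF x] z[OF x] by simp
    have "(\<Sum>i. - q x * picard q (2 * i + 1) x) = - q x * y2 x"
      using suminf_mult[OF s1[OF x], of "- q x"] y2(1)[OF x] by (simp add: sums_iff)
    then show "((\<lambda>x. z2 x + 1) has_real_derivative - q x * y2 x) (at x within {0..1})"
      using DERIV_add[OF z2(2)[OF x] DERIV_const[of 1]] by simp
  qed
  moreover have "y2 0 = 0" "z2 0 = 0"
    using y2(1)[of 0] z2(1)[of 0] by (auto simp: picard_zero sums_iff)
  ultimately show ?thesis by (intro exI[of _ y2] exI[of _ "\<lambda>x. z2 x + 1"]) simp
qed

section \<open>Energy estimate and Green's identity\<close>

text \<open>The energy \<open>w^2 + w'^2\<close> has derivative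
  \<open>2 w w' (1 - q) - 2 w' r\<close>, which is at most \<open>2 + Q\<close> times the energy
  plus \<open>R^2\<close> by \<open>2 |a b| \<le> a^2 + b^2\<close>; then Gronwall applies. The
  source \<open>r\<close> is there for differences of two solutions.\<close>

lemma energy_estimate:
  fixes w w' q r :: "real \<Rightarrow> real"
  assumes cont: "continuous_on {0..1} w" "continuous_on {0..1} w'"
    and der: "\<And>x. x \<in> {0<..<1} \<Longrightarrow> (w has_real_derivative w' x) (at x)"
      "\<And>x. x \<in> {0<..<1} \<Longrightarrow> (w' has_real_derivative - q x * w x - r x) (at x)"
    and Q: "\<And>x. x \<in> {0..1} \<Longrightarrow> \<bar>q x\<bar> \<le> Q" and R: "\<And>x. x \<in> {0..1} \<Longrightarrow> \<bar>r x\<bar> \<le> R"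
    and x: "x \<in> {0..1}"
  shows "(w x)\<^sup>2 + (w' x)\<^sup>2 \<le> ((w 0)\<^sup>2 + (w' 0)\<^sup>2 + R\<^sup>2) * exp (2 + Q)"
proof -
  have Q0: "Q \<ge> 0" using Q[of 0] by auto
  let ?E = "\<lambda>x. (w x)\<^sup>2 + (w' x)\<^sup>2"
  have "?E x \<le> (?E 0 + R\<^sup>2 * (x - 0)) * exp ((2 + Q) * (x - 0))"
  proof (rule gronwall_linear[where E' = "\<lambda>t. 2 * w t * w' t + 2 * w' t * (- q t * w t - r t)"])
    fix t assume "0 < t" "t < x"
    with x have t: "t \<in> {0<..<1}" by auto
    show "(?E has_real_derivative 2 * w t * w' t + 2 * w' t * (- q t * w t - r t)) (at t)"
      using der[OF t] by (auto intro!: derivative_eq_intros)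
    have am: "2 * (\<bar>a\<bar> * \<bar>b\<bar>) \<le> a\<^sup>2 + b\<^sup>2" for a b :: real
      using sum_squares_ge_zero[of "\<bar>a\<bar> - \<bar>b\<bar>" 0] by (simp add: power2_eq_square algebra_simps)
    have "2 * w t * w' t * (1 - q t) \<le> (2 * (\<bar>w t\<bar> * \<bar>w' t\<bar>)) * (1 + Q)"
    proof -
      have "2 * w t * w' t * (1 - q t) \<le> \<bar>2 * w t * w' t * (1 - q t)\<bar>" by simp
      also have "\<dots> = (2 * (\<bar>w t\<bar> * \<bar>w' t\<bar>)) * \<bar>1 - q t\<bar>" by (simp add: abs_mult)
      also have "\<dots> \<le> (2 * (\<bar>w t\<bar> * \<bar>w' t\<bar>)) * (1 + Q)"
        using Q[of t] t by (intro mult_left_mono) auto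
      finally show ?thesis .
    qed
    also have "\<dots> \<le> ?E t * (1 + Q)"
      using am Q0 by (intro mult_right_mono) auto
    finally have 1: "2 * w t * w' t * (1 - q t) \<le> ?E t * (1 + Q)" .
    have "- 2 * w' t * r t \<le> 2 * (\<bar>w' t\<bar> * \<bar>r t\<bar>)"
      using abs_ge_self[of "- 2 * w' t * r t"] by (simp add: abs_mult)
    also have "\<dots> \<le> (w' t)\<^sup>2 + (r t)\<^sup>2" by (rule am)
    also have "(r t)\<^sup>2 \<le> R\<^sup>2" using R[of t] t by (simp add: abs_le_square_iff[symmetric])
    finally have 2: "- 2 * w' t * r t \<le> ?E t + R\<^sup>2" using zero_le_power2[of "w t"] by linarith
    show "2 * w t * w' t + 2 * w' t * (- q t * w t - r t) \<le> (2 + Q) * ?E t + R\<^sup>2"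
      using 1 2 by (simp add: algebra_simps)
  next
    show "continuous_on {0..x} ?E"
      using x by (intro continuous_intros continuous_on_subset[OF cont(1)] continuous_on_subset[OF cont(2)]) auto
  qed (use x Q0 in auto)
  also have "\<dots> \<le> (?E 0 + R\<^sup>2) * exp (2 + Q)"
    using x Q0 by (intro mult_mono add_left_mono) (auto intro!: mult_left_le mult_nonneg_nonneg add_nonneg_nonneg)
  finally show ?thesis .
qed

lemma square_le_imp_abs_le:
  fixes a M :: real
  assumes "a\<^sup>2 \<le> M" "M \<ge> 1"
  shows "\<bar>a\<bar> \<le> M"
proof -
  have "a\<^sup>2 \<le> M\<^sup>2" using assms by (simp add: power2_eq_square order_trans[OF _ mult_left_mono[of 1]])
  then show ?thesis using assms by (simp add: abs_le_square_iff[symmetric])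
qed

text \<open>The integrand is the derivative of the Wronskian \<open>f g' - f' g\<close>, which
  vanishes at both ends. Writing the second derivatives as \<open>- a\<close> and \<open>- b\<close>
  covers inhomogeneous equations as well.\<close>

lemma green_identity:
  fixes f f' a g g' b :: "real \<Rightarrow> real"
  assumes "\<And>x. x \<in> {0..1} \<Longrightarrow> (f has_real_derivative f' x) (at x within {0..1})"
    and "\<And>x. x \<in> {0..1} \<Longrightarrow> (f' has_real_derivative - a x) (at x within {0..1})"
    and "\<And>x. x \<in> {0..1} \<Longrightarrow> (g has_real_derivative g' x) (at x within {0..1})"
    and "\<And>x. x \<in> {0..1} \<Longrightarrow> (g' has_real_derivative - b x) (at x within {0..1})"
    and "f 0 = 0" "f 1 = 0" "g 0 = 0" "g 1 = 0"
  shows "((\<lambda>x. a x * g x - f x * b x) has_integral 0) {0..1}"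
proof -
  have "((\<lambda>x. a x * g x - f x * b x) has_integral
      (f 1 * g' 1 - f' 1 * g 1) - (f 0 * g' 0 - f' 0 * g 0)) {0..1}"
  proof (rule fundamental_theorem_of_calculus)
    fix x :: real assume "x \<in> {0..1}"
    note d = assms(1-4)[OF this]
    show "((\<lambda>x. f x * g' x - f' x * g x) has_vector_derivative a x * g x - f x * b x) (at x within {0..1})"
      unfolding has_real_derivative_iff_has_vector_derivative[symmetric]
      by (rule derivative_eq_intros d refl)+ simp
  qed simp
  then show ?thesis using assms by simp
qed

section \<open>The initial value problem with parameters\<close>

definition potential :: "(real \<Rightarrow> real) \<Rightarrow> real \<times> real \<Rightarrow> real \<Rightarrow> real" where
  "potential m p x = fst p + snd p * m x"

text \<open>A choice of the pair \<open>(y, y')\<close>; \<open>Y_unique\<close> shows that its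
  first component is determined on \<open>[0, 1]\<close>.\<close>

definition ivp :: "(real \<Rightarrow> real) \<Rightarrow> real \<times> real \<Rightarrow> (real \<Rightarrow> real) \<times> (real \<Rightarrow> real)" where
  "ivp m p = (SOME z. ode_solution (potential m p) (fst z) (snd z) \<and> fst z 0 = 0 \<and> snd z 0 = 1)"

locale sturm_liouville =
  fixes m :: "real \<Rightarrow> real"
  assumes cont_m: "continuous_on {0..1} m"
    and bound_m: "\<And>x. x \<in> {0..1} \<Longrightarrow> \<bar>m x\<bar> \<le> 1"
begin

abbreviation q where "q \<equiv> potential m"
definition Y where "Y p = fst (ivp m p)"
definition Y' where "Y' p = snd (ivp m p)"

lemma cont_q: "continuous_on {0..1} (q p)"
  unfolding potential_def by (intro continuous_intros cont_m)

section \<open>Bounds and continuous dependence on the parameters\<close>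

lemma q_diff: "x \<in> {0..1} \<Longrightarrow> \<bar>q p x - q p' x\<bar> \<le> 2 * norm (p - p')"
proof -
  assume x: "x \<in> {0..1}"
  have "\<bar>q p x - q p' x\<bar> = \<bar>fst (p - p') + snd (p - p') * m x\<bar>"
    by (simp add: potential_def algebra_simps)
  also have "\<dots> \<le> \<bar>fst (p - p')\<bar> + \<bar>snd (p - p')\<bar> * \<bar>m x\<bar>"
    by (metis abs_mult abs_triangle_ineq)
  also have "\<dots> \<le> norm (p - p') + norm (p - p') * 1"
    using norm_fst_le[of "fst (p - p')" "snd (p - p')"] norm_snd_le[of "snd (p - p')" "fst (p - p')"] bound_m[OF x]
    by (intro add_mono mult_mono) (auto simp del: fst_diff snd_diff)
  finally show ?thesis by simp
qed

lemma q_bound: "x \<in> {0..1} \<Longrightarrow> norm p \<le> R \<Longrightarrow> \<bar>q p x\<bar> \<le> 2 * R"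
  using q_diff[of x p "(0, 0)"] by (simp add: potential_def flip: zero_prod_def)

lemma Y_solution: "ode_solution (q p) (Y p) (Y' p)" and Y_0 [simp]: "Y p 0 = 0" and Y'_0 [simp]: "Y' p 0 = 1"
proof -
  have "\<exists>z. ode_solution (q p) (fst z) (snd z) \<and> fst z 0 = 0 \<and> snd z 0 = 1"
    using ode_solution_exists[OF cont_q, of p] by auto
  from someI_ex[OF this] show "ode_solution (q p) (Y p) (Y' p)" "Y p 0 = 0" "Y' p 0 = 1"
    by (auto simp: Y_def Y'_def ivp_def)
qed

lemmas Y_der = ode_solutionD[OF Y_solution]

lemma Y_bound:
  assumes R: "norm p \<le> R" and x: "x \<in> {0..1}"
  shows "\<bar>Y p x\<bar> \<le> exp (2 + 2 * R)" "\<bar>Y' p x\<bar> \<le> exp (2 + 2 * R)"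
proof -
  have "0 \<le> R" using R norm_ge_zero[of p] by linarith
  have "(Y p x)\<^sup>2 + (Y' p x)\<^sup>2 \<le> ((Y p 0)\<^sup>2 + (Y' p 0)\<^sup>2 + 0\<^sup>2) * exp (2 + 2 * R)"
    by (rule energy_estimate[where q = "q p" and r = "\<lambda>x. 0"])
       (use Y_der[where p = p] R x q_bound in auto)
  then have "(Y p x)\<^sup>2 + (Y' p x)\<^sup>2 \<le> exp (2 + 2 * R)" by simp
  then have "(Y p x)\<^sup>2 \<le> exp (2 + 2 * R)" "(Y' p x)\<^sup>2 \<le> exp (2 + 2 * R)"
    using zero_le_power2[of "Y p x"] zero_le_power2[of "Y' p x"] by linarith+
  then show "\<bar>Y p x\<bar> \<le> exp (2 + 2 * R)" "\<bar>Y' p x\<bar> \<le> exp (2 + 2 * R)"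
    using square_le_imp_abs_le \<open>0 \<le> R\<close> by auto
qed

text \<open>The difference \<open>w = u - Y p\<close> has zero initial data and satisfies
  \<open>w'' = - f w - (f - q p) Y p\<close>, so the energy estimate applies with a source of size
  \<open>\<eta> * exp (2 + 2 * R)\<close>. Taking for \<open>f\<close> another potential gives
  Lipschitz dependence on \<open>p\<close>; taking \<open>\<eta> = 0\<close> gives
  uniqueness.\<close>

lemma ivp_diff:
  assumes sol: "ode_solution f u u'" "u 0 = 0" "u' 0 = 1" and f: "\<And>x. x \<in> {0..1} \<Longrightarrow> \<bar>f x - q p x\<bar> \<le> \<eta>"
    and R: "norm p \<le> R" and Q: "\<And>x. x \<in> {0..1} \<Longrightarrow> \<bar>f x\<bar> \<le> 2 * R" and x: "x \<in> {0..1}"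
  shows "\<bar>u x - Y p x\<bar> \<le> \<eta> * exp (4 + 4 * R)"
proof -
  have R0: "0 \<le> R" using R norm_ge_zero[of p] by linarith
  have \<eta>0: "0 \<le> \<eta>" using f[of 0] by auto
  let ?w = "\<lambda>x. u x - Y p x" and ?w' = "\<lambda>x. u' x - Y' p x"
  have E: "(?w x)\<^sup>2 + (?w' x)\<^sup>2 \<le> ((?w 0)\<^sup>2 + (?w' 0)\<^sup>2 + (\<eta> * exp (2 + 2 * R))\<^sup>2) * exp (2 + 2 * R)"
  proof (rule energy_estimate[where q = f and r = "\<lambda>x. (f x - q p x) * Y p x"])
    fix t :: real assume t: "t \<in> {0<..<1}"
    show "(?w has_real_derivative ?w' t) (at t)"
      by (intro DERIV_diff ode_solutionD(3)[OF sol(1) t] Y_der(3) t)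
    show "(?w' has_real_derivative - f t * ?w t - (f t - q p t) * Y p t) (at t)"
      by (rule DERIV_cong[OF DERIV_diff[OF ode_solutionD(4)[OF sol(1) t] Y_der(4)[OF t]]])
         (simp add: algebra_simps)
  next
    fix t :: real assume t: "t \<in> {0..1}"
    show "\<bar>(f t - q p t) * Y p t\<bar> \<le> \<eta> * exp (2 + 2 * R)"
      unfolding abs_mult using f[OF t] Y_bound[OF R t] \<eta>0 by (intro mult_mono) auto
  qed (use x Q in \<open>auto intro!: continuous_intros ode_solutionD(5,6)[OF sol(1)] Y_der(5,6)\<close>)
  \<comment> \<open>The factor \<open>exp (2 + 2 * R)\<close> is enlarged to its square to make the
    right-hand side a perfect square.\<close>
  also have "\<dots> \<le> (\<eta> * exp (2 + 2 * R))\<^sup>2 * (exp (2 + 2 * R))\<^sup>2"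
    using sol R0 by (simp add: power2_eq_square mult_left_mono)
  finally have "(?w x)\<^sup>2 \<le> (\<eta> * exp (2 + 2 * R) * exp (2 + 2 * R))\<^sup>2"
    using zero_le_power2[of "?w' x"] unfolding power_mult_distrib by linarith
  then have "\<bar>?w x\<bar> \<le> \<bar>\<eta> * exp (2 + 2 * R) * exp (2 + 2 * R)\<bar>"
    by (simp only: abs_le_square_iff)
  also have "\<dots> = \<eta> * exp (4 + 4 * R)"
    using \<eta>0 by (simp add: mult.assoc abs_mult flip: exp_add)
  finally show ?thesis .
qed

lemma Y_lipschitz:
  assumes "norm p \<le> R" "norm p' \<le> R" "x \<in> {0..1}"
  shows "\<bar>Y p x - Y p' x\<bar> \<le> 2 * norm (p - p') * exp (4 + 4 * R)"
  by (rule ivp_diff[OF Y_solution]) (use assms q_diff q_bound in auto)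

lemma Y_unique:
  assumes "ode_solution (q p) u u'" "u 0 = 0" "u' 0 = 1" "x \<in> {0..1}"
  shows "u x = Y p x"
  using ivp_diff[OF assms(1-3), of p 0 "norm p" x] q_bound assms by simp

text \<open>\<open>Y\<close> is Lipschitz in \<open>p\<close> uniformly in \<open>x\<close>, and
  Lipschitz in \<open>x\<close> by the bound on \<open>Y'\<close>, both with constants uniform on
  bounded sets of \<open>p\<close>. Joint continuity is what makes \<open>G\<close> and
  \<open>H\<close> continuous.\<close>

lemma Y_continuous: "continuous_on (UNIV \<times> {0..1}) (\<lambda>(p, x). Y p x)"
  unfolding continuous_on_def
proof clarify
  fix p0 :: "real \<times> real" and x0 :: real assume x0: "x0 \<in> {0..1}"
  define R where "R = norm p0 + 1"
  let ?F = "at (p0, x0) within UNIV \<times> {0..1}"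
  have "((\<lambda>z. case z of (p, x) \<Rightarrow> Y p x - Y p0 x0) \<longlongrightarrow> 0) ?F"
  proof (rule Lim_null_comparison)
    show "((\<lambda>z. 2 * norm (fst z - p0) * exp (4 + 4 * R) + exp (2 + 2 * R) * norm (snd z - x0)) \<longlongrightarrow> 0) ?F"
      by (auto intro!: tendsto_eq_intros)
    have "((\<lambda>z. norm (fst z)) \<longlongrightarrow> norm p0) ?F" by (auto intro!: tendsto_eq_intros)
    then have "\<forall>\<^sub>F z in ?F. norm (fst z) < R"
      by (rule order_tendstoD) (simp add: R_def)
    moreover have "\<forall>\<^sub>F z in ?F. z \<in> UNIV \<times> {0..1}"
      by (simp add: eventually_at_filter)
    ultimately show "\<forall>\<^sub>F z in ?F. norm (case z of (p, x) \<Rightarrow> Y p x - Y p0 x0)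
        \<le> 2 * norm (fst z - p0) * exp (4 + 4 * R) + exp (2 + 2 * R) * norm (snd z - x0)"
    proof eventually_elim
      fix z :: "(real \<times> real) \<times> real" assume z: "norm (fst z) < R" "z \<in> UNIV \<times> {0..1}"
      obtain p x where px: "z = (p, x)" by (cases z)
      have "norm (Y p0 x - Y p0 x0) \<le> exp (2 + 2 * R) * norm (x - x0)"
        by (rule field_differentiable_bound[where S = "{0..1}" and f' = "Y' p0"])
           (use Y_der(1)[of _ p0] Y_bound[of p0 R] z x0 px in \<open>auto simp: R_def\<close>)
      moreover have "\<bar>Y p x - Y p0 x\<bar> \<le> 2 * norm (p - p0) * exp (4 + 4 * R)"
        by (rule Y_lipschitz) (use z px in \<open>auto simp: R_def\<close>)
      ultimately show "norm (case z of (p, x) \<Rightarrow> Y p x - Y p0 x0)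
        \<le> 2 * norm (fst z - p0) * exp (4 + 4 * R) + exp (2 + 2 * R) * norm (snd z - x0)"
        by (simp add: px)
    qed
  qed
  then show "((\<lambda>(p, x). Y p x) \<longlongrightarrow> Y p0 x0) ?F"
    by (subst Lim_null) (simp add: case_prod_unfold)
qed

lemma continuous_on_Y [continuous_intros]:
  assumes "continuous_on S f" "continuous_on S g" "\<And>z. z \<in> S \<Longrightarrow> g z \<in> {0..1}"
  shows "continuous_on S (\<lambda>z. Y (f z) (g z))"
  using continuous_on_compose2[OF Y_continuous continuous_on_Pair[OF assms(1,2)]] assms(3)
  by (auto simp: image_subset_iff)

lemma continuous_on_m [continuous_intros]:
  assumes "continuous_on S g" "\<And>z. z \<in> S \<Longrightarrow> g z \<in> {0..1}"
  shows "continuous_on S (\<lambda>z. m (g z))"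
  by (rule continuous_on_compose2[OF cont_m assms(1)]) (use assms(2) in auto)

section \<open>The bilinear integrals and Green's identity for two eigenfunctions\<close>

definition G where "G p p' = integral {0..1} (\<lambda>x. Y p x * Y p' x)"
definition H where "H p p' = integral {0..1} (\<lambda>x. m x * Y p x * Y p' x)"

lemma integrable_G: "(\<lambda>x. Y p x * Y p' x) integrable_on {0..1}"
  and integrable_H: "(\<lambda>x. m x * Y p x * Y p' x) integrable_on {0..1}"
  by (auto intro!: integrable_continuous_real continuous_intros)

lemma continuous_on_integral_param:
  fixes f :: "'b::topological_space \<Rightarrow> real \<Rightarrow> real"
  assumes "continuous_on (UNIV \<times> {0..1}) (\<lambda>(z, x). f z x)"
  shows "continuous_on UNIV (\<lambda>z. integral {0..1} (f z))"
  using integral_continuous_on_param[of UNIV 0 1 f] assms by simp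

lemma continuous_G: "continuous_on UNIV (\<lambda>z. G (fst z) (snd z))"
  and continuous_H: "continuous_on UNIV (\<lambda>z. H (fst z) (snd z))"
  unfolding G_def H_def
  by (rule continuous_on_integral_param, unfold case_prod_unfold, intro continuous_intros; auto)+

text \<open>Green's identity for \<open>Y p\<close> and \<open>Y p'\<close>: the difference of the
  potentials is affine in \<open>p - p'\<close>. Without division it also covers equal first or
  equal second components.\<close>

lemma eigen_identity:
  assumes "Y p 1 = 0" "Y p' 1 = 0"
  shows "(fst p - fst p') * G p p' + (snd p - snd p') * H p p' = 0"
proof -
  have "((\<lambda>x. (q p x * Y p x) * Y p' x - Y p x * (q p' x * Y p' x)) has_integral 0) {0..1}"
    by (rule green_identity[where f' = "Y' p" and g' = "Y' p'"])
       (use Y_der(1,2) assms in auto)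
  moreover have "((\<lambda>x. (fst p - fst p') * (Y p x * Y p' x) + (snd p - snd p') * (m x * Y p x * Y p' x))
     has_integral ((fst p - fst p') * G p p' + (snd p - snd p') * H p p')) {0..1}"
    unfolding G_def H_def
    by (intro has_integral_add has_integral_mult_right integrable_integral integrable_G integrable_H)
  ultimately show ?thesis
    unfolding potential_def by (intro has_integral_unique) (auto simp: algebra_simps)
qed

section \<open>Eigenvalues as zeros of the shooting function\<close>

lemma Y_nontrivial: "\<exists>x\<in>{0<..<1}. Y p x \<noteq> 0"
proof (rule ccontr)
  assume "\<not> ?thesis"
  then have 0: "Y p x = 0" if "x \<in> {0<..<1}" for x using that by auto
  have "Y' p x = 0" if x: "x \<in> {0<..<1}" for x
  proof -
    have "((\<lambda>x. 0) has_real_derivative Y' p x) (at x)"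
      using has_field_derivative_transform_within_open[OF Y_der(3)[OF x] _ x] 0 by simp
    then show ?thesis using DERIV_unique[OF _ DERIV_const] by blast
  qed
  then have "Y' p 0 = 0"
    by (rule continuous_constant_on_closure[where S = "{0<..<1}", rotated 1])
       (simp_all add: Y_der(6))
  then show False by simp
qed

text \<open>For \<open>q \<le> 0\<close> the derivative \<open>Y'^2 - q Y^2\<close> of
  \<open>Y Y'\<close> is nonnegative, so \<open>Y Y' \<ge> 0\<close> and \<open>Y^2\<close> is
  nondecreasing; \<open>Y 1 = 0\<close> would force \<open>Y = 0\<close>. This bounds the
  eigenvalues from below.\<close>

lemma Y_1_nonzero:
  assumes neg: "\<And>x. x \<in> {0..1} \<Longrightarrow> q p x \<le> 0"
  shows "Y p 1 \<noteq> 0"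
proof
  assume Y1: "Y p 1 = 0"
  have pos: "Y p x * Y' p x \<ge> 0" if x: "x \<in> {0..1}" for x
  proof -
    have "Y p 0 * Y' p 0 \<le> Y p x * Y' p x"
    proof (rule DERIV_nonneg_imp_increasing_open[where f = "\<lambda>x. Y p x * Y' p x"])
      fix t assume "0 < t" "t < x"
      then have t: "t \<in> {0<..<1}" using x by auto
      have "((\<lambda>x. Y p x * Y' p x) has_real_derivative Y' p t * Y' p t + (- q p t) * (Y p t * Y p t)) (at t)"
        by (rule derivative_eq_intros Y_der(3,4) t refl)+ (simp add: algebra_simps)
      moreover have "Y' p t * Y' p t + (- q p t) * (Y p t * Y p t) \<ge> 0"
        using neg[of t] t by (intro add_nonneg_nonneg[OF _ mult_nonneg_nonneg]) auto
      ultimately show "\<exists>y. ((\<lambda>x. Y p x * Y' p x) has_real_derivative y) (at t) \<and> 0 \<le> y" by blast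
    qed (use x in \<open>auto intro!: continuous_intros continuous_on_subset[OF Y_der(6)]\<close>)
    then show ?thesis by simp
  qed
  have "Y p x = 0" if x: "x \<in> {0<..<1}" for x
  proof -
    have "Y p x * Y p x \<le> Y p 1 * Y p 1"
    proof (rule DERIV_nonneg_imp_increasing_open[where f = "\<lambda>x. Y p x * Y p x"])
      fix t assume "x < t" "t < 1"
      then have t: "t \<in> {0<..<1}" using x by auto
      have "((\<lambda>x. Y p x * Y p x) has_real_derivative 2 * (Y p t * Y' p t)) (at t)"
        by (rule derivative_eq_intros Y_der(3) t refl)+ (simp add: algebra_simps)
      then show "\<exists>y. ((\<lambda>x. Y p x * Y p x) has_real_derivative y) (at t) \<and> 0 \<le> y"
        using pos[of t] t by auto
    qed (use x in \<open>auto intro!: continuous_intros\<close>)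
    then show ?thesis using Y1 by (auto simp: mult_le_0_iff)
  qed
  then show False using Y_nontrivial[of p] by blast
qed

text \<open>The work is in showing that an eigenfunction \<open>\<phi>\<close>, differentiable only
  inside the interval, forces \<open>Y 1 = 0\<close>. Its Wronskian with \<open>Y\<close> is
  constant and tends to 0 at the left end; if \<open>Y 1 \<noteq> 0\<close>, this makes
  \<open>\<phi>\<close> and \<open>\<phi>'\<close> both tend to 0 at the right end, and then
  \<open>\<phi> = 0\<close> by Gronwall.\<close>

lemma eigenvalue_iff: "dirichlet_eigenvalue m \<mu> \<sigma> \<longleftrightarrow> Y (\<sigma>, \<mu>) 1 = 0"
proof
  let ?p = "(\<sigma>, \<mu>)"
  assume 0: "Y ?p 1 = 0"
  have "dirichlet_eigenfunction m \<mu> \<sigma> (Y ?p)"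
    unfolding dirichlet_eigenfunction_def
  proof (intro conjI)
    show "\<exists>\<phi>' \<phi>''. \<forall>x\<in>{0<..<1}. (Y ?p has_real_derivative \<phi>' x) (at x) \<and>
        (\<phi>' has_real_derivative \<phi>'' x) (at x) \<and> - \<phi>'' x - \<mu> * m x * Y ?p x = \<sigma> * Y ?p x"
      by (rule exI[of _ "Y' ?p"], rule exI[of _ "\<lambda>x. - q ?p x * Y ?p x"])
         (use Y_der(3,4) in \<open>auto simp: potential_def algebra_simps\<close>)
  qed (use Y_der(5) 0 Y_nontrivial in auto)
  then show "dirichlet_eigenvalue m \<mu> \<sigma>" unfolding dirichlet_eigenvalue_def by blast
next
  let ?p = "(\<sigma>, \<mu>)"
  assume "dirichlet_eigenvalue m \<mu> \<sigma>"
  then obtain \<phi> \<phi>' \<phi>'' where cont: "continuous_on {0..1} \<phi>" and \<phi>0: "\<phi> 0 = 0" and \<phi>1: "\<phi> 1 = 0"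
    and nz: "\<exists>x\<in>{0<..<1}. \<phi> x \<noteq> 0"
    and d: "\<And>x. x \<in> {0<..<1} \<Longrightarrow> (\<phi> has_real_derivative \<phi>' x) (at x)"
     "\<And>x. x \<in> {0<..<1} \<Longrightarrow> (\<phi>' has_real_derivative \<phi>'' x) (at x)"
     "\<And>x. x \<in> {0<..<1} \<Longrightarrow> - \<phi>'' x - \<mu> * m x * \<phi> x = \<sigma> * \<phi> x"
    unfolding dirichlet_eigenvalue_def dirichlet_eigenfunction_def by blast
  have d2: "(\<phi>' has_real_derivative - q ?p x * \<phi> x) (at x)" if "x \<in> {0<..<1}" for x
  proof -
    have "\<phi>'' x = - q ?p x * \<phi> x"
      using d(3)[OF that] unfolding potential_def fst_conv snd_conv by algebra
    then show ?thesis using d(2)[OF that] by simp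
  qed
  \<comment> \<open>\<open>C\<close> bounds \<open>|1 - q|\<close>. Interior points are less than 1
    apart, so the energies at any two of them are comparable with the fixed factor
    \<open>exp C\<close>.\<close>
  define C where "C = 1 + 2 * norm ?p"
  let ?E = "\<lambda>x. (\<phi> x)\<^sup>2 + (\<phi>' x)\<^sup>2"
  have E: "?E x \<le> ?E z * exp C" if xz: "x \<in> {0<..<1}" "z \<in> {0<..<1}" for x z
  proof -
    have "?E x \<le> ?E z * exp (C * \<bar>x - z\<bar>)"
    proof (rule gronwall_two_sided[OF _ _ _ xz, where E' = "\<lambda>x. 2 * \<phi> x * \<phi>' x * (1 - q ?p x)"])
      fix x :: real assume x: "x \<in> {0<..<1}"
      show "(?E has_real_derivative 2 * \<phi> x * \<phi>' x * (1 - q ?p x)) (at x)"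
        by (rule derivative_eq_intros d(1) d2 x refl)+ (simp add: algebra_simps)
      have "2 * (\<bar>\<phi> x\<bar> * \<bar>\<phi>' x\<bar>) \<le> ?E x"
        using sum_squares_ge_zero[of "\<bar>\<phi> x\<bar> - \<bar>\<phi>' x\<bar>" 0] by (simp add: power2_eq_square algebra_simps)
      moreover have "\<bar>1 - q ?p x\<bar> \<le> C"
        using q_bound[of x ?p "norm ?p"] x unfolding C_def by auto
      ultimately have "(2 * (\<bar>\<phi> x\<bar> * \<bar>\<phi>' x\<bar>)) * \<bar>1 - q ?p x\<bar> \<le> ?E x * C"
        by (intro mult_mono) auto
      then show "\<bar>2 * \<phi> x * \<phi>' x * (1 - q ?p x)\<bar> \<le> C * ?E x" 
        unfolding abs_mult by (simp add: mult_ac)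
    qed (simp add: C_def)
    also have "?E z * exp (C * \<bar>x - z\<bar>) \<le> ?E z * exp C"
    proof -
      have "\<bar>x - z\<bar> \<le> 1" using xz by auto
      then show ?thesis
        by (intro mult_left_mono) (simp_all add: C_def mult_left_le)
    qed
    finally show ?thesis .
  qed
  have "(\<lambda>x. \<phi> x * Y' ?p x - \<phi>' x * Y ?p x) constant_on {0<..<1}"
  proof (rule has_field_derivative_0_imp_constant_on)
    fix x :: real assume x: "x \<in> {0<..<1}"
    show "((\<lambda>x. \<phi> x * Y' ?p x - \<phi>' x * Y ?p x) has_real_derivative 0) (at x)"
      by (rule derivative_eq_intros d(1) d2 Y_der(3,4) x refl)+ (simp add: algebra_simps)
  qed auto
  then obtain W where W: "\<And>x. x \<in> {0<..<1} \<Longrightarrow> \<phi> x * Y' ?p x - \<phi>' x * Y ?p x = W"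
    unfolding constant_on_def by blast
  have "\<bar>\<phi>' x\<bar> \<le> 1 + ?E (1/2) * exp C" if "x \<in> {0<..<1}" for x
  proof -
    have "?E x \<le> ?E (1/2) * exp C" by (rule E[OF that]) simp
    then have "(\<phi>' x)\<^sup>2 \<le> 1 + ?E (1/2) * exp C" using zero_le_power2[of "\<phi> x"] by linarith
    then show ?thesis by (intro square_le_imp_abs_le) (auto intro!: mult_nonneg_nonneg add_nonneg_nonneg)
  qed
  then have Bfun: "Bfun \<phi>' (at_right 0)"
    by (intro BfunI[where K = "1 + ?E (1/2) * exp C"]) 
       (auto simp: eventually_at_right[of 0 1] intro!: exI[of _ 1])
  have lim: "((\<lambda>x. f x) \<longlongrightarrow> f 0) (at_right 0) \<and> ((\<lambda>x. f x) \<longlongrightarrow> f 1) (at_left 1)"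
    if "continuous_on {0..1} f" for f :: "real \<Rightarrow> real"
    using that by (auto simp: continuous_on_def at_within_Icc_at_left[of 0 1] at_within_Icc_at_right[of 0 1]
        dest: bspec[of _ _ 0] bspec[of _ _ 1])
  have ev0: "\<forall>\<^sub>F x in at_right 0. x \<in> {0<..<1::real}" and ev1: "\<forall>\<^sub>F x in at_left 1. x \<in> {0<..<1::real}"
    by (simp_all only: eventually_at_right_real eventually_at_left_real zero_less_one)
  \<comment> \<open>At the left end \<open>\<phi>\<close> tends to 0 while \<open>Y'\<close> tends
    to 1, and \<open>\<phi>'\<close> stays bounded while \<open>Y\<close> tends to 0.\<close>
  have "((\<lambda>x. \<phi> x * Y' ?p x - \<phi>' x * Y ?p x) \<longlongrightarrow> \<phi> 0 * Y' ?p 0 - 0) (at_right 0)"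
  proof (intro tendsto_diff tendsto_mult)
    have "(Y ?p \<longlongrightarrow> 0) (at_right 0)" using lim[OF Y_der(5)[of ?p]] by simp
    then have "Zfun (Y ?p) (at_right 0)" by (simp add: tendsto_Zfun_iff)
    from bounded_bilinear.Bfun_prod_Zfun[OF bounded_bilinear_mult Bfun this]
    show "((\<lambda>x. \<phi>' x * Y ?p x) \<longlongrightarrow> 0) (at_right 0)" by (simp add: tendsto_Zfun_iff)
  qed (use lim[OF Y_der(6)[of ?p]] lim[OF cont] in auto)
  moreover have "\<forall>\<^sub>F x in at_right 0. \<phi> x * Y' ?p x - \<phi>' x * Y ?p x = W"
    using ev0 by (rule eventually_mono) (rule W)
  ultimately have "((\<lambda>x. W) \<longlongrightarrow> 0) (at_right (0::real))"
    using \<phi>0 by (auto elim: Lim_transform_eventually)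
  then have W0: "W = 0" by (simp add: tendsto_const_iff)
  show "Y ?p 1 = 0"
  proof (rule ccontr)
    assume nz1: "Y ?p 1 \<noteq> 0"
    have Y1: "(Y ?p \<longlongrightarrow> Y ?p 1) (at_left 1)" using lim[OF Y_der(5)[of ?p]] by simp
    have f1: "(\<phi> \<longlongrightarrow> 0) (at_left 1)" using lim[OF cont] \<phi>1 by simp
    have "((\<lambda>x. \<phi> x * Y' ?p x / Y ?p x) \<longlongrightarrow> 0 * Y' ?p 1 / Y ?p 1) (at_left 1)"
      using lim[OF Y_der(6)[of ?p]] by (intro tendsto_intros Y1 f1 nz1) auto
    \<comment> \<open>The vanishing Wronskian expresses \<open>\<phi>'\<close> through
      \<open>\<phi>\<close>, which gives \<open>\<phi>'\<close> the limit 0.\<close>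
    moreover have "\<forall>\<^sub>F x in at_left 1. \<phi> x * Y' ?p x / Y ?p x = \<phi>' x"
      using ev1 tendsto_imp_eventually_ne[OF Y1 nz1]
    proof eventually_elim
      case (elim x)
      then show ?case using W[of x] W0 by (simp add: field_simps)
    qed
    ultimately have f2: "(\<phi>' \<longlongrightarrow> 0) (at_left 1)"
      by (auto elim: Lim_transform_eventually)
    have "?E x \<le> 0" if x: "x \<in> {0<..<1}" for x
    proof (rule tendsto_lowerbound)
      show "((\<lambda>z. ?E z * exp C) \<longlongrightarrow> 0) (at_left 1)"
        using f1 f2 by (auto intro!: tendsto_eq_intros)
      show "\<forall>\<^sub>F z in at_left 1. ?E x \<le> ?E z * exp C"
        using ev1 by (rule eventually_mono) (rule E[OF x])
    qed simp
    then have "\<phi> x = 0" if "x \<in> {0<..<1}" for x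
      using that by (meson sum_power2_le_zero_iff)
    then show False using nz by blast
  qed
qed

subsection \<open>Eigenvalue branches near the unperturbed problem\<close>

lemma G_pos: "G p p > 0"
proof -
  have "integral {0..1} (\<lambda>x. Y p x * Y p x) \<ge> 0"
    by (intro integral_nonneg integrable_G) simp
  moreover have "integral {0..1} (\<lambda>x. Y p x * Y p x) \<noteq> 0"
  proof
    assume "integral {0..1} (\<lambda>x. Y p x * Y p x) = 0"
    then have "\<forall>x\<in>{0..1}. Y p x * Y p x = 0"
      by (subst (asm) integral_eq_0_iff) (auto intro!: continuous_intros)
    then show False using Y_nontrivial[of p] by auto
  qed
  ultimately show ?thesis unfolding G_def by linarith
qed

lemma tendsto_G:
  assumes "(f \<longlongrightarrow> a) F" "(g \<longlongrightarrow> b) F"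
  shows "((\<lambda>x. G (f x) (g x)) \<longlongrightarrow> G a b) F"
  using continuous_on_tendsto_compose[OF continuous_G tendsto_Pair[OF assms]] by simp

lemma tendsto_H:
  assumes "(f \<longlongrightarrow> a) F" "(g \<longlongrightarrow> b) F"
  shows "((\<lambda>x. H (f x) (g x)) \<longlongrightarrow> H a b) F"
  using continuous_on_tendsto_compose[OF continuous_H tendsto_Pair[OF assms]] by simp

text \<open>Both inequalities are strict at \<open>(p0, p0)\<close>: \<open>G p0 p0 > 0\<close>, and
  for the chosen \<open>L\<close> the difference \<open>L * G p0 p0 - |H p0 p0|\<close> equals
  \<open>G p0 p0\<close>. Continuity extends them to nearby pairs.\<close>

lemma H_dominated_by_G:
  "\<exists>\<delta>>0. \<exists>L\<ge>0. \<forall>p p'. dist p p0 < \<delta> \<longrightarrow> dist p' p0 < \<delta> \<longrightarrow> 0 < G p p' \<and> \<bar>H p p'\<bar> \<le> L * G p p'"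
proof -
  define L where "L = \<bar>H p0 p0\<bar> / G p0 p0 + 1"
  let ?F = "nhds (p0, p0)"
  have id: "((\<lambda>z. fst z) \<longlongrightarrow> p0) ?F" "((\<lambda>z. snd z) \<longlongrightarrow> p0) ?F"
    by (auto intro!: tendsto_eq_intros filterlim_ident)
  have "\<forall>\<^sub>F z in ?F. 0 < G (fst z) (snd z)"
    using order_tendstoD(1)[OF tendsto_G[OF id] G_pos] .
  moreover have "((\<lambda>z. L * G (fst z) (snd z) - \<bar>H (fst z) (snd z)\<bar>) \<longlongrightarrow> L * G p0 p0 - \<bar>H p0 p0\<bar>) ?F"
    by (intro tendsto_intros tendsto_G tendsto_H id)
  then have "\<forall>\<^sub>F z in ?F. 0 < L * G (fst z) (snd z) - \<bar>H (fst z) (snd z)\<bar>"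
    by (rule order_tendstoD) (use G_pos[of p0] in \<open>simp add: L_def field_simps\<close>)
  ultimately have "\<forall>\<^sub>F z in ?F. 0 < G (fst z) (snd z) \<and> \<bar>H (fst z) (snd z)\<bar> \<le> L * G (fst z) (snd z)"
    by eventually_elim simp
  then obtain d where d: "d > 0" "\<And>z. dist z (p0, p0) < d \<Longrightarrow>
      0 < G (fst z) (snd z) \<and> \<bar>H (fst z) (snd z)\<bar> \<le> L * G (fst z) (snd z)"
    unfolding eventually_nhds_metric by blast
  have "0 < G p p' \<and> \<bar>H p p'\<bar> \<le> L * G p p'" if "dist p p0 < d / 2" "dist p' p0 < d / 2" for p p'
  proof -
    have "dist (p, p') (p0, p0) \<le> dist p p0 + dist p' p0"
      by (simp add: dist_Pair_Pair sqrt_sum_squares_le_sum)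
    also have "\<dots> < d" using that by simp
    finally show ?thesis using d(2)[of "(p, p')"] by simp
  qed
  moreover have "L \<ge> 0" using G_pos[of p0] by (simp add: L_def)
  ultimately show ?thesis using d(1) by (intro exI[of _ "d/2"] exI[of _ L] conjI) auto
qed

text \<open>Absolute values in \<open>eigen_identity\<close>, then cancellation of
  \<open>G p p'\<close>. For equal second components it says that the two eigenvalues coincide,
  which is how local uniqueness is obtained.\<close>

lemma eigen_lipschitz:
  assumes "Y p 1 = 0" "Y p' 1 = 0" "0 < G p p'" "\<bar>H p p'\<bar> \<le> L * G p p'"
  shows "\<bar>fst p - fst p'\<bar> \<le> L * \<bar>snd p - snd p'\<bar>"
proof -
  have "(fst p - fst p') * G p p' = - ((snd p - snd p') * H p p')"
    using eigen_identity[OF assms(1,2)] by simp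
  then have "\<bar>fst p - fst p'\<bar> * G p p' = \<bar>snd p - snd p'\<bar> * \<bar>H p p'\<bar>"
    using assms(3) by (metis abs_minus_cancel abs_mult abs_of_pos)
  also have "\<dots> \<le> \<bar>snd p - snd p'\<bar> * (L * G p p')"
    by (intro mult_left_mono assms) simp
  finally have "\<bar>fst p - fst p'\<bar> * G p p' \<le> (L * \<bar>snd p - snd p'\<bar>) * G p p'"
    by (simp add: mult_ac)
  then show ?thesis using assms(3) by simp
qed

section \<open>The unperturbed spectrum\<close>

text \<open>For \<open>n \<ge> 1\<close> this is the \<open>n\<close>-th eigenvalue at
  \<open>\<mu> = 0\<close>; see \<open>S_0\<close>.\<close>

definition e :: "nat \<Rightarrow> real" where "e n = (real n * pi)\<^sup>2"

text \<open>Consecutive squares differ by at least 1 and \<open>pi^2 > 9\<close>. The gap 2 keeps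
  windows of radius at most 1 around these numbers disjoint and ordered.\<close>

lemma e_gap: "i < j \<Longrightarrow> e i + 2 < e j"
proof -
  assume "i < j"
  then have "(real i + 1)\<^sup>2 \<le> (real j)\<^sup>2" by (intro power_mono) auto
  then have "(real i)\<^sup>2 + 1 \<le> (real j)\<^sup>2" by (simp add: power2_eq_square algebra_simps)
  then have "((real i)\<^sup>2 + 1) * pi\<^sup>2 \<le> (real j)\<^sup>2 * pi\<^sup>2" by (intro mult_right_mono) auto
  moreover have "3 * 3 < pi * pi" by (intro mult_strict_mono pi_gt3) auto
  ultimately show ?thesis by (simp add: e_def power_mult_distrib power2_eq_square algebra_simps)
qed

lemma Y_free:
  assumes s: "s > 0" and x: "x \<in> {0..1}"
  shows "Y (s\<^sup>2, 0) x = sin (s * x) / s"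
proof -
  have "sin (s * x) / s = Y (s\<^sup>2, 0) x"
  proof (rule Y_unique[where u' = "\<lambda>x. cos (s * x)"])
    show "ode_solution (q (s\<^sup>2, 0)) (\<lambda>x. sin (s * x) / s) (\<lambda>x. cos (s * x))"
      unfolding ode_solution_def potential_def using s
      by (auto intro!: derivative_eq_intros simp: power2_eq_square)
  qed (use x in auto)
  then show ?thesis by simp
qed

lemma Y_free_zero:
  assumes "Y (\<sigma>, 0) 1 = 0"
  shows "\<exists>j\<ge>1. \<sigma> = e j"
proof -
  have "\<sigma> > 0"
  proof (rule ccontr)
    assume "\<not> \<sigma> > 0"
    then show False using Y_1_nonzero[of "(\<sigma>, 0)"] assms by (simp add: potential_def)
  qed
  then have \<sigma>: "\<sigma> = (sqrt \<sigma>)\<^sup>2" "sqrt \<sigma> > 0" by auto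
  have "sin (sqrt \<sigma>) = 0"
    using assms Y_free[OF \<sigma>(2), of 1] \<sigma> by auto
  then obtain i :: int where i: "sqrt \<sigma> = of_int i * pi" by (auto simp: sin_zero_iff_int2)
  then have "i > 0" using \<sigma>(2) by (simp add: zero_less_mult_iff)
  then have "sqrt \<sigma> = real (nat i) * pi" "nat i \<ge> 1" using i by auto
  then show ?thesis using \<sigma>(1) unfolding e_def by metis
qed

section \<open>Localising and counting eigenvalues for small perturbations\<close>

text \<open>On the compact set \<open>K\<close>, the range \<open>[-1, B]\<close> with the windows
  removed, \<open>Y (\<sigma>, 0) 1\<close> has no zero and so is bounded away from 0; Lipschitz
  dependence preserves this for small \<open>\<mu>\<close>. Values below \<open>-1\<close> are
  excluded by \<open>Y_1_nonzero\<close> as soon as \<open>|\<mu>| < 1\<close>.\<close>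

lemma eigenvalue_localisation:
  assumes \<delta>: "\<delta> > 0"
  shows "\<forall>\<^sub>F \<mu> in nhds 0. \<forall>\<sigma>. Y (\<sigma>, \<mu>) 1 = 0 \<longrightarrow> \<sigma> \<le> e (Suc N) - \<delta> \<longrightarrow> (\<exists>j\<in>{1..N}. \<bar>\<sigma> - e j\<bar> < \<delta>)"
proof -
  define B where "B = e (Suc N) - \<delta>"
  define K where "K = {-1..B} - (\<Union>j\<in>{1..N}. ball (e j) \<delta>)"
  define R where "R = 2 + \<bar>B\<bar>"
  have "compact K" unfolding K_def by (intro compact_diff open_UN) auto
  have nz: "Y (\<sigma>, 0) 1 \<noteq> 0" if "\<sigma> \<in> K" for \<sigma>
  proof
    assume "Y (\<sigma>, 0) 1 = 0"
    then obtain j where j: "j \<ge> 1" "\<sigma> = e j" using Y_free_zero by blast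
    have "e j < e (Suc N)" using that j \<delta> by (auto simp: K_def B_def)
    then have "j \<le> N" using e_gap[of "Suc N" j] by (cases "j = Suc N") force+
    then have "\<sigma> \<in> (\<Union>j\<in>{1..N}. ball (e j) \<delta>)" using j \<delta> by force
    then show False using that by (simp add: K_def)
  qed
  have "\<exists>c>0. \<forall>\<sigma>\<in>K. c \<le> \<bar>Y (\<sigma>, 0) 1\<bar>"
  proof (cases "K = {}")
    case True then show ?thesis by (auto intro: exI[of _ 1])
  next
    case False
    have "continuous_on K (\<lambda>\<sigma>. \<bar>Y (\<sigma>, 0) 1\<bar>)" by (intro continuous_intros) auto
    from continuous_attains_inf[OF \<open>compact K\<close> False this] nz show ?thesis
      by (metis zero_less_abs_iff)
  qed
  then obtain c where c: "c > 0" "\<And>\<sigma>. \<sigma> \<in> K \<Longrightarrow> c \<le> \<bar>Y (\<sigma>, 0) 1\<bar>" by blast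
  have "((\<lambda>\<mu>. 2 * \<bar>\<mu>\<bar> * exp (4 + 4 * R)) \<longlongrightarrow> 2 * \<bar>0\<bar> * exp (4 + 4 * R)) (nhds 0)"
    by (intro tendsto_intros filterlim_ident)
  then have "\<forall>\<^sub>F \<mu> in nhds 0. 2 * \<bar>\<mu>\<bar> * exp (4 + 4 * R) < c"
    by (rule order_tendstoD) (use c in simp)
  moreover have "\<forall>\<^sub>F \<mu> in nhds 0. \<bar>\<mu>\<bar> < (1::real)"
    using eventually_nhds_ball[of 1 "0::real"] by (simp add: dist_norm)
  ultimately show ?thesis
  proof eventually_elim
    fix \<mu> :: real assume \<mu>: "2 * \<bar>\<mu>\<bar> * exp (4 + 4 * R) < c" "\<bar>\<mu>\<bar> < 1"
    show "\<forall>\<sigma>. Y (\<sigma>, \<mu>) 1 = 0 \<longrightarrow> \<sigma> \<le> e (Suc N) - \<delta> \<longrightarrow> (\<exists>j\<in>{1..N}. \<bar>\<sigma> - e j\<bar> < \<delta>)"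
    proof (intro allI impI)
      fix \<sigma> assume \<sigma>: "Y (\<sigma>, \<mu>) 1 = 0" "\<sigma> \<le> e (Suc N) - \<delta>"
      have "\<sigma> \<ge> -1"
      proof (rule ccontr)
        assume "\<not> \<sigma> \<ge> -1"
        moreover have "\<mu> * m x \<le> 1" if "x \<in> {0..1}" for x
        proof -
          have "\<bar>\<mu> * m x\<bar> \<le> 1 * 1"
            unfolding abs_mult using \<mu> bound_m[OF that] by (intro mult_mono) auto
          then show ?thesis by simp
        qed
        ultimately have "q (\<sigma>, \<mu>) x \<le> 0" if "x \<in> {0..1}" for x
          using that by (force simp: potential_def)
        then show False using Y_1_nonzero \<sigma>(1) by blast
      qed
      have nb: "norm (\<sigma>, \<nu>) \<le> R" if "\<bar>\<nu>\<bar> < 1" for \<nu> :: real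
      proof -
        have "norm (\<sigma>, \<nu>) \<le> \<bar>\<sigma>\<bar> + \<bar>\<nu>\<bar>" using norm_Pair_le[of \<sigma> \<nu>] by (simp only: real_norm_def)
        then show ?thesis using \<open>\<sigma> \<ge> -1\<close> \<sigma>(2) that unfolding R_def B_def by linarith
      qed
      have "\<bar>Y (\<sigma>, \<mu>) 1 - Y (\<sigma>, 0) 1\<bar> \<le> 2 * norm ((\<sigma>, \<mu>) - (\<sigma>, 0)) * exp (4 + 4 * R)"
        by (rule Y_lipschitz) (use nb[of \<mu>] nb[of 0] \<mu> in auto)
      then have "\<bar>Y (\<sigma>, 0) 1\<bar> < c" using \<mu> \<sigma>(1) by simp
      then have "\<sigma> \<notin> K" using c(2)[of \<sigma>] by auto
      then show "\<exists>j\<in>{1..N}. \<bar>\<sigma> - e j\<bar> < \<delta>"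
        using \<open>\<sigma> \<ge> -1\<close> \<sigma>(2) by (auto simp: K_def B_def dist_norm abs_minus_commute)
    qed
  qed
qed

text \<open>\<open>\<sigma> \<mapsto> Y (\<sigma>, 0) 1\<close> changes sign across
  \<open>e j\<close>. The opposite signs at two fixed points \<open>a\<close> and \<open>b\<close>
  persist for small \<open>\<mu>\<close>, and the intermediate value theorem gives a zero between
  them.\<close>

lemma eigenvalue_near:
  assumes j: "j \<ge> 1" and \<delta>: "\<delta> > 0"
  shows "\<forall>\<^sub>F \<mu> in nhds 0. \<exists>\<sigma>. \<bar>\<sigma> - e j\<bar> < \<delta> \<and> Y (\<sigma>, \<mu>) 1 = 0"
proof -
  define s where "s = real j * pi"
  have "1 * pi \<le> s" unfolding s_def using j by (intro mult_right_mono) auto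
  then have s: "s > 3" using pi_gt3 by linarith
  \<comment> \<open>With \<open>h \<le> 1\<close> both \<open>(s - h)^2\<close> and
    \<open>(s + h)^2\<close> are within \<open>h * (2 * s + 1) < \<delta>\<close> of
    \<open>s^2 = e j\<close>, and \<open>sin h > 0\<close>.\<close>
  define h where "h = min 1 (\<delta> / (2 * (2 * s + 1)))"
  have h: "h > 0" "h \<le> 1" "h \<le> \<delta> / (2 * (2 * s + 1))" using \<delta> s by (auto simp: h_def)
  have "h * (2 * s + 1) \<le> \<delta> / (2 * (2 * s + 1)) * (2 * s + 1)"
    using h s by (intro mult_right_mono) auto
  also have "\<dots> < \<delta>" using s \<delta> by (simp add: field_simps add_pos_pos)
  finally have hd: "h * (2 * s + 1) < \<delta>" .
  have hh: "h * h \<le> h" using h mult_left_le[of h h] by simp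
  define a where "a = (s - h)\<^sup>2"
  define b where "b = (s + h)\<^sup>2"
  have ab: "a \<le> b" unfolding a_def b_def using h s by (intro power_mono) auto
  have near: "\<bar>\<sigma> - e j\<bar> < \<delta>" if "a \<le> \<sigma>" "\<sigma> \<le> b" for \<sigma>
  proof -
    have "e j = s * s" "a = s * s - 2 * (h * s) + h * h" "b = s * s + 2 * (h * s) + h * h"
      "h * (2 * s + 1) = 2 * (h * s) + h"
      by (simp_all add: e_def s_def a_def b_def power2_eq_square algebra_simps)
    moreover have "h * h \<ge> 0" by simp
    ultimately show ?thesis using that hd hh unfolding abs_less_iff by linarith
  qed
  have sin_s: "sin s = 0" "(cos s)\<^sup>2 = 1"
    using sin_cos_squared_add[of s] by (simp_all add: s_def)
  have sh: "0 < sin h" using h pi_gt3 by (intro sin_gt_zero) auto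
  \<comment> \<open>Working with the product avoids a distinction by the parity of
    \<open>j\<close>.\<close>
  have "sin (s - h) * sin (s + h) = - ((cos s)\<^sup>2 * (sin h)\<^sup>2)"
    by (simp add: sin_diff sin_add sin_s(1) power2_eq_square algebra_simps)
  also have "\<dots> < 0" using sh sin_s(2) by simp
  finally have "Y (a, 0) 1 * Y (b, 0) 1 < 0"
    using Y_free[of "s - h" 1] Y_free[of "s + h" 1] h s
    by (simp add: a_def b_def divide_less_0_iff)
  moreover have "continuous_on UNIV (\<lambda>\<mu>. Y (a, \<mu>) 1 * Y (b, \<mu>) 1)"
    by (intro continuous_intros) auto
  then have "((\<lambda>\<mu>. Y (a, \<mu>) 1 * Y (b, \<mu>) 1) \<longlongrightarrow> Y (a, 0) 1 * Y (b, 0) 1) (nhds 0)"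
    by (intro continuous_on_tendsto_compose[where s = UNIV and f = "\<lambda>\<mu>. Y (a, \<mu>) 1 * Y (b, \<mu>) 1"] filterlim_ident) auto
  ultimately have "\<forall>\<^sub>F \<mu> in nhds 0. Y (a, \<mu>) 1 * Y (b, \<mu>) 1 < 0" by (intro order_tendstoD)
  then show ?thesis
  proof eventually_elim
    case (elim \<mu>)
    have cont: "continuous_on {a..b} (\<lambda>\<sigma>. Y (\<sigma>, \<mu>) 1)" by (intro continuous_intros) auto
    have "\<exists>\<sigma>\<ge>a. \<sigma> \<le> b \<and> Y (\<sigma>, \<mu>) 1 = 0"
      using elim IVT'[OF _ _ ab cont, of 0] IVT2'[OF _ _ ab cont, of 0]
      by (auto simp: mult_less_0_iff)
    then show ?case using near by blast
  qed
qed

lemma dist_Pair_le: "dist (a, b) (c, d) \<le> \<bar>a - c\<bar> + \<bar>b - d\<bar>" for a b c d :: real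
  by (simp add: dist_Pair_Pair dist_real_def sqrt_sum_squares_le_sum_abs)

text \<open>Of two eigenvalues the larger has strictly more eigenvalues below it, so the count
  determines the eigenvalue and the definite description is met.\<close>

lemma nth_eigenvalue_eqI:
  assumes "dirichlet_eigenvalue m \<mu> \<sigma>"
    "finite {\<tau>. dirichlet_eigenvalue m \<mu> \<tau> \<and> \<tau> < \<sigma>}"
    "card {\<tau>. dirichlet_eigenvalue m \<mu> \<tau> \<and> \<tau> < \<sigma>} + 1 = n"
  shows "nth_dirichlet_eigenvalue m n \<mu> = \<sigma>"
proof -
  let ?A = "\<lambda>\<sigma>. {\<tau>. dirichlet_eigenvalue m \<mu> \<tau> \<and> \<tau> < \<sigma>}"
  have less: False if "\<sigma> < \<sigma>'" "finite (?A \<sigma>')" "dirichlet_eigenvalue m \<mu> \<sigma>"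
    "card (?A \<sigma>) = card (?A \<sigma>')" for \<sigma> \<sigma>'
  proof -
    have "?A \<sigma> \<subset> ?A \<sigma>'" using that(1,3) by (auto simp: psubset_eq)
    from psubset_card_mono[OF that(2) this] that(4) show False by simp
  qed
  show ?thesis unfolding nth_dirichlet_eigenvalue_def
  proof (rule the_equality)
    fix \<tau> assume "dirichlet_eigenvalue m \<mu> \<tau> \<and> finite (?A \<tau>) \<and> card (?A \<tau>) + 1 = n"
    then show "\<tau> = \<sigma>" using less[of \<sigma> \<tau>] less[of \<tau> \<sigma>] assms by (cases \<tau> \<sigma> rule: linorder_cases) auto
  qed (use assms in auto)
qed

abbreviation S where "S \<equiv> nth_dirichlet_eigenvalue m"

text \<open>For small \<open>\<mu>\<close> each window around \<open>e 1\<close>, ...,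
  \<open>e n\<close> contains exactly one eigenvalue, by \<open>eigenvalue_near\<close> and
  \<open>eigen_lipschitz\<close>, and there are no others up to \<open>e (Suc n) - d\<close>. Hence
  the one near \<open>e n\<close> has \<open>n - 1\<close> eigenvalues below it.\<close>

lemma nth_eigenvalue_near:
  assumes n: "n \<ge> 1" and \<delta>: "\<delta> > 0"
  shows "\<forall>\<^sub>F \<mu> in nhds 0. \<bar>S n \<mu> - e n\<bar> < \<delta> \<and> Y (S n \<mu>, \<mu>) 1 = 0"
proof -
  have "\<exists>d>0. \<forall>\<sigma> \<sigma>' \<mu>. \<bar>\<sigma> - e j\<bar> < d \<longrightarrow> \<bar>\<sigma>' - e j\<bar> < d \<longrightarrow> \<bar>\<mu>\<bar> < d \<longrightarrow>
      Y (\<sigma>, \<mu>) 1 = 0 \<longrightarrow> Y (\<sigma>', \<mu>) 1 = 0 \<longrightarrow> \<sigma> = \<sigma>'" for j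
  proof -
    obtain d L where d: "d > 0" "\<And>p p'. dist p (e j, 0) < d \<Longrightarrow> dist p' (e j, 0) < d \<Longrightarrow>
        0 < G p p' \<and> \<bar>H p p'\<bar> \<le> L * G p p'"
      using H_dominated_by_G[of "(e j, 0)"] by blast
    show ?thesis
    proof (intro exI[of _ "d / 2"] conjI allI impI)
      fix \<sigma> \<sigma>' \<mu> assume a: "\<bar>\<sigma> - e j\<bar> < d / 2" "\<bar>\<sigma>' - e j\<bar> < d / 2" "\<bar>\<mu>\<bar> < d / 2"
        and z: "Y (\<sigma>, \<mu>) 1 = 0" "Y (\<sigma>', \<mu>) 1 = 0"
      have "dist (\<sigma>, \<mu>) (e j, 0) < d" "dist (\<sigma>', \<mu>) (e j, 0) < d"
        using dist_Pair_le[of \<sigma> \<mu> "e j" 0] dist_Pair_le[of \<sigma>' \<mu> "e j" 0] a by auto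
      from eigen_lipschitz[OF z conjunct1[OF d(2)[OF this]] conjunct2[OF d(2)[OF this]]]
      show "\<sigma> = \<sigma>'" by simp
    qed (use d in simp)
  qed
  then obtain D where D: "\<And>j. D j > 0" "\<And>j \<sigma> \<sigma>' \<mu>. \<bar>\<sigma> - e j\<bar> < D j \<Longrightarrow> \<bar>\<sigma>' - e j\<bar> < D j \<Longrightarrow> \<bar>\<mu>\<bar> < D j \<Longrightarrow>
      Y (\<sigma>, \<mu>) 1 = 0 \<Longrightarrow> Y (\<sigma>', \<mu>) 1 = 0 \<Longrightarrow> \<sigma> = \<sigma>'"
    by metis
  \<comment> \<open>One radius for all windows: at most 1 for their order, at most
    \<open>\<delta>\<close> for the claim, at most each \<open>D j\<close> for uniqueness.\<close>
  define d where "d = Min (insert 1 (insert \<delta> (D ` {1..n})))"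
  have d: "d > 0" "d \<le> 1" "d \<le> \<delta>" "\<And>j. j \<in> {1..n} \<Longrightarrow> d \<le> D j"
    unfolding d_def by (use D(1) \<delta> in simp) (rule Min_le; simp)+
  have "\<forall>\<^sub>F \<mu> in nhds 0. \<forall>j\<in>{1..n}. \<exists>\<sigma>. \<bar>\<sigma> - e j\<bar> < d \<and> Y (\<sigma>, \<mu>) 1 = 0"
    by (intro eventually_ball_finite ballI eigenvalue_near d) auto
  moreover have "\<forall>\<^sub>F \<mu> in nhds 0. \<bar>\<mu>\<bar> < d"
    using eventually_nhds_ball[of d "0::real"] d by (simp add: dist_norm)
  ultimately show ?thesis using eigenvalue_localisation[OF d(1), of n]
  proof eventually_elim
    fix \<mu> :: real
    assume ex: "\<forall>j\<in>{1..n}. \<exists>\<sigma>. \<bar>\<sigma> - e j\<bar> < d \<and> Y (\<sigma>, \<mu>) 1 = 0" and \<mu>: "\<bar>\<mu>\<bar> < d"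
      and loc: "\<forall>\<sigma>. Y (\<sigma>, \<mu>) 1 = 0 \<longrightarrow> \<sigma> \<le> e (Suc n) - d \<longrightarrow> (\<exists>j\<in>{1..n}. \<bar>\<sigma> - e j\<bar> < d)"
    from ex obtain s where s: "\<And>j. j \<in> {1..n} \<Longrightarrow> \<bar>s j - e j\<bar> < d" "\<And>j. j \<in> {1..n} \<Longrightarrow> Y (s j, \<mu>) 1 = 0"
      by metis
    have mono: "s i < s j" if "i < j" "i \<in> {1..n}" "j \<in> {1..n}" for i j
      using s(1)[OF that(2)] s(1)[OF that(3)] e_gap[OF that(1)] d(2) by linarith
    have uniq: "\<sigma> = s j" if "j \<in> {1..n}" "\<bar>\<sigma> - e j\<bar> < d" "Y (\<sigma>, \<mu>) 1 = 0" for \<sigma> j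
      using D(2)[of \<sigma> j "s j" \<mu>] d(4)[OF that(1)] s[OF that(1)] that \<mu> by simp
    have nn: "n \<in> {1..n}" using n by simp
    have set: "{\<tau>. Y (\<tau>, \<mu>) 1 = 0 \<and> \<tau> < s n} = s ` {1..<n}"
    proof (intro equalityI subsetI)
      fix \<tau> assume "\<tau> \<in> {\<tau>. Y (\<tau>, \<mu>) 1 = 0 \<and> \<tau> < s n}"
      then have \<tau>: "Y (\<tau>, \<mu>) 1 = 0" "\<tau> < s n" by auto
      have "\<tau> \<le> e (Suc n) - d" using \<tau>(2) s(1)[OF nn] e_gap[of n "Suc n"] d(2) by simp
      then obtain j where j: "j \<in> {1..n}" "\<bar>\<tau> - e j\<bar> < d" using loc \<tau> by blast
      then have "\<tau> = s j" using uniq \<tau> by blast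
      moreover have "j \<noteq> n" using \<open>\<tau> = s j\<close> \<tau>(2) by auto
      ultimately show "\<tau> \<in> s ` {1..<n}" using j by auto
    next
      fix \<tau> assume "\<tau> \<in> s ` {1..<n}"
      then obtain j where j: "j \<in> {1..<n}" "\<tau> = s j" by auto
      then show "\<tau> \<in> {\<tau>. Y (\<tau>, \<mu>) 1 = 0 \<and> \<tau> < s n}" using s(2)[of j] mono[of j n] n by auto
    qed
    have "inj_on s {1..<n}"
    proof (rule linorder_inj_onI)
      fix i j assume "i < j" "i \<in> {1..<n}" "j \<in> {1..<n}"
      then show "s i \<noteq> s j" using mono[of i j] by auto
    qed auto
    then have "card (s ` {1..<n}) + 1 = n" using n by (simp add: card_image)
    then have "S n \<mu> = s n"
      using s(2)[OF nn] set by (intro nth_eigenvalue_eqI) (simp_all add: eigenvalue_iff)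
    then show "\<bar>S n \<mu> - e n\<bar> < \<delta> \<and> Y (S n \<mu>, \<mu>) 1 = 0"
      using s[OF nn] d(3) by simp
  qed
qed

text \<open>Otherwise \<open>|S n 0 - e n|\<close> could serve as the radius in
  \<open>nth_eigenvalue_near\<close>, which at \<open>\<mu> = 0\<close> would make it smaller than
  itself.\<close>

lemma S_0: "n \<ge> 1 \<Longrightarrow> S n 0 = e n"
proof (rule ccontr)
  assume n: "n \<ge> 1" and "S n 0 \<noteq> e n"
  then show False
    using eventually_nhds_x_imp_x[OF nth_eigenvalue_near[OF n, of "\<bar>S n 0 - e n\<bar>"]] by simp
qed

section \<open>The eigenvalue branch and its first derivative\<close>

lemma eigenvalue_branch:
  assumes n: "n \<ge> 1"
  obtains \<epsilon> L where "\<epsilon> > 0" "L \<ge> 0"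
    "\<And>\<mu>. \<bar>\<mu>\<bar> < \<epsilon> \<Longrightarrow> Y (S n \<mu>, \<mu>) 1 = 0"
    "\<And>\<mu> \<nu>. \<bar>\<mu>\<bar> < \<epsilon> \<Longrightarrow> \<bar>\<nu>\<bar> < \<epsilon> \<Longrightarrow> G (S n \<mu>, \<mu>) (S n \<nu>, \<nu>) > 0"
    "\<And>\<mu> \<nu>. \<bar>\<mu>\<bar> < \<epsilon> \<Longrightarrow> \<bar>\<nu>\<bar> < \<epsilon> \<Longrightarrow> \<bar>S n \<mu> - S n \<nu>\<bar> \<le> L * \<bar>\<mu> - \<nu>\<bar>"
proof -
  obtain d L where d: "d > 0" "L \<ge> 0" "\<And>p p'. dist p (e n, 0) < d \<Longrightarrow> dist p' (e n, 0) < d \<Longrightarrow>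
      0 < G p p' \<and> \<bar>H p p'\<bar> \<le> L * G p p'"
    using H_dominated_by_G[of "(e n, 0)"] by blast
  have "\<forall>\<^sub>F \<mu> in nhds 0. \<bar>S n \<mu> - e n\<bar> < d / 2 \<and> Y (S n \<mu>, \<mu>) 1 = 0"
    using nth_eigenvalue_near[OF n, of "d / 2"] d by simp
  then obtain r where r: "r > 0" "\<And>\<mu>. \<bar>\<mu>\<bar> < r \<Longrightarrow> \<bar>S n \<mu> - e n\<bar> < d / 2 \<and> Y (S n \<mu>, \<mu>) 1 = 0"
    unfolding eventually_nhds_metric dist_real_def by auto
  let ?P = "\<lambda>\<mu>. (S n \<mu>, \<mu>)"
  have dist: "dist (?P \<mu>) (e n, 0) < d" if "\<bar>\<mu>\<bar> < min r (d / 2)" for \<mu>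
    using dist_Pair_le[of "S n \<mu>" \<mu> "e n" 0] r(2)[of \<mu>] that by auto
  show thesis
  proof (rule that[of "min r (d / 2)" L])
    fix \<mu> \<nu> assume a: "\<bar>\<mu>\<bar> < min r (d / 2)" "\<bar>\<nu>\<bar> < min r (d / 2)"
    note GH = d(3)[OF dist[OF a(1)] dist[OF a(2)]]
    then show "G (?P \<mu>) (?P \<nu>) > 0" by blast
    show "\<bar>S n \<mu> - S n \<nu>\<bar> \<le> L * \<bar>\<mu> - \<nu>\<bar>"
      using eigen_lipschitz[of "?P \<mu>" "?P \<nu>" L] GH r(2)[of \<mu>] r(2)[of \<nu>] a by simp
  qed (use r d in auto)
qed

text \<open>By \<open>eigen_identity\<close> the difference quotient between \<open>\<mu>\<close>
  and \<open>\<nu>\<close> equals \<open>- H / G\<close> at the corresponding pair of points, and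
  the branch is continuous. The formula holds on a neighbourhood of 0, so it can be differentiated
  again there.\<close>

lemma S_has_derivative:
  assumes n: "n \<ge> 1"
  shows "\<forall>\<^sub>F \<mu> in nhds 0. (S n has_real_derivative - H (S n \<mu>, \<mu>) (S n \<mu>, \<mu>) / G (S n \<mu>, \<mu>) (S n \<mu>, \<mu>)) (at \<mu>)"
proof -
  obtain \<epsilon> L where b: "\<epsilon> > 0" "L \<ge> 0"
    "\<And>\<mu>. \<bar>\<mu>\<bar> < \<epsilon> \<Longrightarrow> Y (S n \<mu>, \<mu>) 1 = 0"
    "\<And>\<mu> \<nu>. \<bar>\<mu>\<bar> < \<epsilon> \<Longrightarrow> \<bar>\<nu>\<bar> < \<epsilon> \<Longrightarrow> G (S n \<mu>, \<mu>) (S n \<nu>, \<nu>) > 0"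
    "\<And>\<mu> \<nu>. \<bar>\<mu>\<bar> < \<epsilon> \<Longrightarrow> \<bar>\<nu>\<bar> < \<epsilon> \<Longrightarrow> \<bar>S n \<mu> - S n \<nu>\<bar> \<le> L * \<bar>\<mu> - \<nu>\<bar>"
    by (rule eigenvalue_branch[OF n]) (rule that)
  have ball: "\<forall>\<^sub>F \<mu> in nhds 0. \<bar>\<mu>\<bar> < \<epsilon>"
    using eventually_nhds_ball[of \<epsilon> "0::real"] b by (simp add: dist_norm)
  show ?thesis
    using ball
  proof eventually_elim
    fix \<nu> :: real assume \<nu>: "\<bar>\<nu>\<bar> < \<epsilon>"
    let ?P = "\<lambda>\<mu>. (S n \<mu>, \<mu>)"
    have ev: "\<forall>\<^sub>F \<mu> in at \<nu>. \<bar>\<mu>\<bar> < \<epsilon>"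
      by (rule order_tendstoD[OF _ \<nu>]) (intro tendsto_intros)
    have "((\<lambda>\<mu>. S n \<mu> - S n \<nu>) \<longlongrightarrow> 0) (at \<nu>)"
    proof (rule Lim_null_comparison)
      show "\<forall>\<^sub>F \<mu> in at \<nu>. norm (S n \<mu> - S n \<nu>) \<le> L * \<bar>\<mu> - \<nu>\<bar>"
        using ev by eventually_elim (use b(5) \<nu> in auto)
      show "((\<lambda>\<mu>. L * \<bar>\<mu> - \<nu>\<bar>) \<longlongrightarrow> 0) (at \<nu>)"
        by (auto intro!: tendsto_eq_intros)
    qed
    then have S: "(S n \<longlongrightarrow> S n \<nu>) (at \<nu>)" by (rule LIM_zero_cancel)
    have P: "(?P \<longlongrightarrow> ?P \<nu>) (at \<nu>)" by (intro tendsto_Pair S tendsto_ident_at)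
    have "((\<lambda>\<mu>. - H (?P \<mu>) (?P \<nu>) / G (?P \<mu>) (?P \<nu>)) \<longlongrightarrow> - H (?P \<nu>) (?P \<nu>) / G (?P \<nu>) (?P \<nu>)) (at \<nu>)"
      using G_pos[of "?P \<nu>"] by (intro tendsto_intros tendsto_G tendsto_H P) auto
    moreover have "\<forall>\<^sub>F \<mu> in at \<nu>. - H (?P \<mu>) (?P \<nu>) / G (?P \<mu>) (?P \<nu>) = (S n \<mu> - S n \<nu>) / (\<mu> - \<nu>)"
      using ev eventually_neq_at_within[of \<nu> \<nu> UNIV]
    proof (eventually_elim)
      fix \<mu> assume \<mu>: "\<bar>\<mu>\<bar> < \<epsilon>" "\<mu> \<noteq> \<nu>"
      have "(S n \<mu> - S n \<nu>) * G (?P \<mu>) (?P \<nu>) + (\<mu> - \<nu>) * H (?P \<mu>) (?P \<nu>) = 0"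
        using eigen_identity[of "?P \<mu>" "?P \<nu>"] b(3) \<mu> \<nu> by simp
      then show "- H (?P \<mu>) (?P \<nu>) / G (?P \<mu>) (?P \<nu>) = (S n \<mu> - S n \<nu>) / (\<mu> - \<nu>)"
        using b(4)[OF \<mu>(1) \<nu>] \<mu>(2) by (simp add: divide_eq_eq eq_divide_eq field_simps)
    qed
    ultimately have "((\<lambda>\<mu>. (S n \<mu> - S n \<nu>) / (\<mu> - \<nu>)) \<longlongrightarrow> - H (?P \<nu>) (?P \<nu>) / G (?P \<nu>) (?P \<nu>)) (at \<nu>)"
      by (rule Lim_transform_eventually)
    then show "(S n has_real_derivative - H (?P \<nu>) (?P \<nu>) / G (?P \<nu>) (?P \<nu>)) (at \<nu>)"
      unfolding has_field_derivative_iff .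
  qed
qed

subsection \<open>Second-order perturbation\<close>

text \<open>The combination is the integral of \<open>m * (Y p - Y p')^2\<close>, hence quadratic in
  \<open>p - p'\<close>. When \<open>H p' p' = 0\<close>, it allows \<open>H p p\<close> to be
  replaced by \<open>2 * H p p'\<close> up to second order.\<close>

lemma H_second_difference:
  assumes R: "norm p \<le> R" "norm p' \<le> R"
  shows "\<bar>H p p - 2 * H p p' + H p' p'\<bar> \<le> (2 * norm (p - p') * exp (4 + 4 * R))\<^sup>2"
proof -
  let ?B = "2 * norm (p - p') * exp (4 + 4 * R)"
  let ?f = "\<lambda>x. m x * Y p x * Y p x - 2 * (m x * Y p x * Y p' x) + m x * Y p' x * Y p' x"
  have eq: "H p p - 2 * H p p' + H p' p' = integral {0..1} ?f"
    unfolding H_def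
    by (rule integral_unique[symmetric])
       (intro has_integral_add has_integral_diff has_integral_mult_right integrable_integral integrable_H)
  have "norm (integral {0..1} ?f) \<le> ?B\<^sup>2 * (1 - 0)"
  proof (rule integral_bound)
    show "norm (?f t) \<le> ?B\<^sup>2" if t: "t \<in> {0..1}" for t
    proof -
      have "?f t = m t * (Y p t - Y p' t)\<^sup>2" by (simp add: power2_eq_square algebra_simps)
      then have "norm (?f t) = \<bar>m t\<bar> * \<bar>Y p t - Y p' t\<bar>\<^sup>2" by (simp add: abs_mult)
      also have "\<dots> \<le> 1 * ?B\<^sup>2"
        using bound_m[OF t] Y_lipschitz[OF R t] by (intro mult_mono power_mono) auto
      finally show "norm (?f t) \<le> ?B\<^sup>2" by simp
    qed
  qed (auto intro!: continuous_intros)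
  then show ?thesis unfolding eq by simp
qed

lemma tendsto_integral_Y:
  assumes g: "continuous_on {0..1} g" and f: "(f \<longlongrightarrow> a) F"
  shows "((\<lambda>x. integral {0..1} (\<lambda>t. g t * Y (f x) t)) \<longlongrightarrow> integral {0..1} (\<lambda>t. g t * Y a t)) F"
proof -
  have "continuous_on (UNIV \<times> {0..1}) (\<lambda>(p, t). g t * Y p t)"
    unfolding case_prod_unfold
    by (intro continuous_intros continuous_on_compose2[OF g continuous_on_snd[OF continuous_on_id]]) auto
  from continuous_on_integral_param[OF this] show ?thesis
    by (rule continuous_on_tendsto_compose) (use f in auto)
qed

lemma deriv_S_0:
  assumes n: "n \<ge> 1" and H0: "H (e n, 0) (e n, 0) = 0"
  shows "\<forall>\<^sub>F \<mu> in nhds 0. S n field_differentiable (at \<mu>)" "deriv (S n) 0 = 0"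
proof -
  show "\<forall>\<^sub>F \<mu> in nhds 0. S n field_differentiable (at \<mu>)"
    using S_has_derivative[OF n] by eventually_elim (auto simp: field_differentiable_def)
  show "deriv (S n) 0 = 0"
    using eventually_nhds_x_imp_x[OF S_has_derivative[OF n]] by (simp add: S_0[OF n] H0 DERIV_imp_deriv)
qed

text \<open>The function \<open>u\<close> below is the first-order response of the eigenfunction \<open>Y (e n, 0)\<close>
  to the perturbation \<open>m\<close>; pairing it with an eigenfunction \<open>Y p\<close> by Green's identity
  trades \<open>H p (e n, 0)\<close> for terms of the next order in \<open>\<mu>\<close>.\<close>

lemma second_order_perturbation:
  fixes u u' :: "real \<Rightarrow> real"
  assumes n: "n \<ge> 1" and H0: "H (e n, 0) (e n, 0) = 0"
    and u: "\<And>x. x \<in> {0..1} \<Longrightarrow> (u has_real_derivative u' x) (at x within {0..1})"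
      "\<And>x. x \<in> {0..1} \<Longrightarrow> (u' has_real_derivative - (e n * u x + m x * Y (e n, 0) x)) (at x within {0..1})"
    and u01: "u 0 = 0" "u 1 = 0"
    and neg: "integral {0..1} (\<lambda>x. m x * u x * Y (e n, 0) x) < 0"
  shows "deriv (S n) field_differentiable (at 0)" "deriv (deriv (S n)) 0 > 0"
    "\<forall>\<^sub>F \<mu> in nhds 0. S n 0 \<le> S n \<mu>" "\<not> concave_on UNIV (S n)"
proof -
  define p0 where "p0 = (e n, 0::real)"
  define P where "P \<mu> = (S n \<mu>, \<mu>)" for \<mu>
  define U where "U p = integral {0..1} (\<lambda>x. u x * Y p x)" for p
  define V where "V p = integral {0..1} (\<lambda>x. (m x * u x) * Y p x)" for p
  have P0: "P 0 = p0" by (simp add: P_def p0_def S_0[OF n])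
  have V0: "V p0 < 0" using neg by (simp add: V_def p0_def)
  have cu: "continuous_on {0..1} u" by (rule DERIV_continuous_on, erule u(1))
  have cmu: "continuous_on {0..1} (\<lambda>x. m x * u x)" by (intro continuous_intros cu cont_m)
  obtain \<epsilon> L where b: "\<epsilon> > 0" "L \<ge> 0"
    "\<And>\<mu>. \<bar>\<mu>\<bar> < \<epsilon> \<Longrightarrow> Y (S n \<mu>, \<mu>) 1 = 0"
    "\<And>\<mu> \<nu>. \<bar>\<mu>\<bar> < \<epsilon> \<Longrightarrow> \<bar>\<nu>\<bar> < \<epsilon> \<Longrightarrow> G (S n \<mu>, \<mu>) (S n \<nu>, \<nu>) > 0"
    "\<And>\<mu> \<nu>. \<bar>\<mu>\<bar> < \<epsilon> \<Longrightarrow> \<bar>\<nu>\<bar> < \<epsilon> \<Longrightarrow> \<bar>S n \<mu> - S n \<nu>\<bar> \<le> L * \<bar>\<mu> - \<nu>\<bar>"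
    by (rule eigenvalue_branch[OF n]) (rule that)
  have ball: "\<forall>\<^sub>F \<mu> in nhds 0. \<bar>\<mu>\<bar> < \<epsilon>"
    using eventually_nhds_ball[of \<epsilon> "0::real"] b by (simp add: dist_norm)
  \<comment> \<open>Green's identity for \<open>Y (P \<mu>)\<close> and \<open>u\<close>: the change
    of potential produces \<open>U\<close> and \<open>V\<close>, the source term of \<open>u\<close>
    produces \<open>H (P \<mu>) p0\<close>.\<close>
  have H: "H (P \<mu>) p0 = (S n \<mu> - S n 0) * U (P \<mu>) + \<mu> * V (P \<mu>)" if "\<bar>\<mu>\<bar> < \<epsilon>" for \<mu>
  proof -
    let ?Y = "Y (P \<mu>)"
    have 1: "((\<lambda>x. (q (P \<mu>) x * ?Y x) * u x - ?Y x * (e n * u x + m x * Y (e n, 0) x)) has_integral 0) {0..1}"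
      by (rule green_identity[where f' = "Y' (P \<mu>)" and g' = u'])
         (use Y_der(1,2) u u01 b(3)[OF that] in \<open>auto simp: P_def\<close>)
    have 2: "((\<lambda>x. (S n \<mu> - S n 0) * (u x * ?Y x) + \<mu> * ((m x * u x) * ?Y x) - m x * ?Y x * Y p0 x)
        has_integral ((S n \<mu> - S n 0) * U (P \<mu>) + \<mu> * V (P \<mu>) - H (P \<mu>) p0)) {0..1}"
      unfolding U_def V_def H_def
      by (intro has_integral_add has_integral_diff has_integral_mult_right integrable_integral integrable_H
          integrable_continuous_real continuous_intros cu cont_m) auto
    have eq: "(\<lambda>x. (q (P \<mu>) x * ?Y x) * u x - ?Y x * (e n * u x + m x * Y (e n, 0) x)) =
       (\<lambda>x. (S n \<mu> - S n 0) * (u x * ?Y x) + \<mu> * ((m x * u x) * ?Y x) - m x * ?Y x * Y p0 x)"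
      by (simp add: fun_eq_iff potential_def P_def p0_def S_0[OF n] algebra_simps)
    show ?thesis using has_integral_unique[OF 1[unfolded eq] 2] by simp
  qed
  have "(S n has_real_derivative 0) (at 0)"
    using eventually_nhds_x_imp_x[OF S_has_derivative[OF n]] by (simp add: S_0[OF n] H0)
  then have S': "((\<lambda>\<mu>. (S n \<mu> - S n 0) / \<mu>) \<longlongrightarrow> 0) (at 0)" and S: "(S n \<longlongrightarrow> S n 0) (nhds 0)"
    using isCont_def DERIV_isCont[of "S n" 0 0] by (auto simp: has_field_derivative_iff tendsto_nhds_iff)
  have P_nhds: "(P \<longlongrightarrow> p0) (nhds 0)"
    unfolding P_def using P0 S by (auto simp: P_def intro!: tendsto_eq_intros filterlim_ident)
  then have P: "(P \<longlongrightarrow> p0) (at 0)" by (rule tendsto_mono[rotated]) (simp add: at_within_def)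

  \<comment> \<open>Inserting the formula for \<open>H\<close> into \<open>eigen_identity\<close>
    leaves only \<open>V\<close> at order \<open>\<mu>^2\<close>. Since \<open>V p0 < 0\<close> and
    \<open>G p0 p0 > 0\<close>, the minimum at 0 is strict, which is also what contradicts
    concavity.\<close>
  have S_eq: "(S n \<mu> - S n 0) * (G (P \<mu>) p0 + \<mu> * U (P \<mu>)) = - (\<mu>\<^sup>2 * V (P \<mu>))" if "\<bar>\<mu>\<bar> < \<epsilon>" for \<mu>
  proof -
    have "(S n \<mu> - S n 0) * G (P \<mu>) p0 + \<mu> * H (P \<mu>) p0 = 0"
      using eigen_identity[of "P \<mu>" "P 0"] b(3)[OF that] b(3)[of 0] b(1) unfolding P0[symmetric] by (simp add: P_def)
    then show ?thesis unfolding H[OF that] by (simp add: power2_eq_square algebra_simps)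
  qed
  have tU: "((\<lambda>\<mu>. U (P \<mu>)) \<longlongrightarrow> U p0) F" and tV: "((\<lambda>\<mu>. V (P \<mu>)) \<longlongrightarrow> V p0) F"
    and tG: "((\<lambda>\<mu>. G (P \<mu>) p0) \<longlongrightarrow> G p0 p0) F" if "(P \<longlongrightarrow> p0) F" for F
    unfolding U_def V_def using that by (auto intro!: tendsto_integral_Y cu cmu tendsto_G)
  have "((\<lambda>\<mu>. G (P \<mu>) p0 + \<mu> * U (P \<mu>)) \<longlongrightarrow> G p0 p0 + 0 * U p0) (nhds 0)"
    by (intro tendsto_intros tU tG P_nhds filterlim_ident)
  then have "\<forall>\<^sub>F \<mu> in nhds 0. 0 < G (P \<mu>) p0 + \<mu> * U (P \<mu>)"
    by (rule order_tendstoD) (use G_pos in simp)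
  moreover have "\<forall>\<^sub>F \<mu> in nhds 0. V (P \<mu>) < 0"
    using order_tendstoD(2)[OF tV[OF P_nhds] V0] .
  ultimately have min: "\<forall>\<^sub>F \<mu> in nhds 0. \<mu> \<noteq> 0 \<longrightarrow> S n 0 < S n \<mu>"
    using ball
  proof eventually_elim
    case (elim \<mu>)
    show ?case
    proof
      assume "\<mu> \<noteq> 0"
      then have "(S n \<mu> - S n 0) * (G (P \<mu>) p0 + \<mu> * U (P \<mu>)) > 0"
        using S_eq[OF elim(3)] elim(2) by (simp add: mult_less_0_iff)
      then show "S n 0 < S n \<mu>" using elim(1) by (simp add: zero_less_mult_iff)
    qed
  qed
  then show "\<forall>\<^sub>F \<mu> in nhds 0. S n 0 \<le> S n \<mu>"
    by eventually_elim (metis less_eq_real_def)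
  show "\<not> concave_on UNIV (S n)"
  proof
    assume conc: "concave_on UNIV (S n)"
    obtain d where d: "d > 0" "\<And>\<mu>. \<bar>\<mu>\<bar> < d \<Longrightarrow> \<mu> \<noteq> 0 \<Longrightarrow> S n 0 < S n \<mu>"
      using min unfolding eventually_nhds_metric dist_real_def by auto
    have "S n ((1 - 1/2) *\<^sub>R (d / 2) + (1/2) *\<^sub>R (- (d / 2))) \<ge> (1 - 1/2) * S n (d / 2) + (1/2) * S n (- (d / 2))"
      by (rule concave_onD[OF conc]) auto
    moreover have "(1 - 1/2) *\<^sub>R (d / 2) + (1/2) *\<^sub>R (- (d / 2)) = 0" by simp
    ultimately show False using d(1) d(2)[of "d / 2"] d(2)[of "- (d / 2)"] by simp
  qed

  define R where "R = norm p0 + 1"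
  have "((\<lambda>\<mu>. norm (P \<mu>)) \<longlongrightarrow> norm p0) (at 0)" by (intro tendsto_intros P)
  then have evR: "\<forall>\<^sub>F \<mu> in at 0. norm (P \<mu>) < R" by (rule order_tendstoD) (simp add: R_def)
  have ball': "\<forall>\<^sub>F \<mu> in at 0. \<bar>\<mu>\<bar> < \<epsilon>" using ball by (simp add: eventually_at_filter eventually_mono)
  \<comment> \<open>As \<open>H p0 p0 = 0\<close> and \<open>P \<mu> - p0\<close> has norm at most
    \<open>(L + 1) * |\<mu>|\<close>, the numerator is of order \<open>\<mu>^2\<close>.\<close>
  have rem: "((\<lambda>\<mu>. (H (P \<mu>) (P \<mu>) - 2 * H (P \<mu>) p0) / \<mu>) \<longlongrightarrow> 0) (at 0)"
  proof (rule Lim_null_comparison)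
    show "\<forall>\<^sub>F \<mu> in at 0. norm ((H (P \<mu>) (P \<mu>) - 2 * H (P \<mu>) p0) / \<mu>)
        \<le> (2 * (L + 1) * exp (4 + 4 * R))\<^sup>2 * \<bar>\<mu>\<bar>"
      using evR ball' eventually_neq_at_within[of 0 0 UNIV]
    proof eventually_elim
      case (elim \<mu>)
      have "norm (P \<mu> - p0) = dist (S n \<mu>, \<mu>) (S n 0, 0)" by (simp add: P0[symmetric] P_def dist_norm)
      also have "\<dots> \<le> \<bar>S n \<mu> - S n 0\<bar> + \<bar>\<mu>\<bar>" using dist_Pair_le[of "S n \<mu>" \<mu> "S n 0" 0] by simp
      also have "\<dots> \<le> (L + 1) * \<bar>\<mu>\<bar>" using b(5)[of \<mu> 0] b(1) elim by (simp add: algebra_simps)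
      finally have nP: "norm (P \<mu> - p0) \<le> (L + 1) * \<bar>\<mu>\<bar>" .
      have "\<bar>H (P \<mu>) (P \<mu>) - 2 * H (P \<mu>) p0\<bar> \<le> (2 * norm (P \<mu> - p0) * exp (4 + 4 * R))\<^sup>2"
        using H_second_difference[of "P \<mu>" R p0] elim(1) H0 by (simp add: R_def p0_def)
      also have "\<dots> \<le> (2 * ((L + 1) * \<bar>\<mu>\<bar>) * exp (4 + 4 * R))\<^sup>2"
        by (intro power_mono mult_right_mono mult_left_mono nP) auto
      also have "\<dots> = (2 * (L + 1) * exp (4 + 4 * R))\<^sup>2 * \<bar>\<mu>\<bar> * \<bar>\<mu>\<bar>"
        unfolding power2_eq_square by (simp only: mult_ac)
      finally show ?case using elim(3) by (simp add: divide_le_eq)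
    qed
    show "((\<lambda>\<mu>. (2 * (L + 1) * exp (4 + 4 * R))\<^sup>2 * \<bar>\<mu>\<bar>) \<longlongrightarrow> 0) (at 0)"
      by (auto intro!: tendsto_eq_intros)
  qed
  define D where "D = - (2 * V p0) / G p0 p0"
  \<comment> \<open>This is the difference quotient of \<open>deriv (S n)\<close> at 0, with
    \<open>H (P \<mu>) (P \<mu>)\<close> split into the negligible remainder and
    \<open>2 * H (P \<mu>) p0\<close>, the latter expanded by \<open>H\<close>. In the limit only
    \<open>V\<close> survives.\<close>
  have "((\<lambda>\<mu>. - ((H (P \<mu>) (P \<mu>) - 2 * H (P \<mu>) p0) / \<mu> +
        2 * ((S n \<mu> - S n 0) / \<mu> * U (P \<mu>) + V (P \<mu>))) / G (P \<mu>) (P \<mu>)) \<longlongrightarrow>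
      - (0 + 2 * (0 * U p0 + V p0)) / G p0 p0) (at 0)"
    using G_pos[of p0] by (intro tendsto_intros rem S' tU tV tendsto_G P) auto
  moreover have "\<forall>\<^sub>F \<mu> in at 0. - ((H (P \<mu>) (P \<mu>) - 2 * H (P \<mu>) p0) / \<mu> +
        2 * ((S n \<mu> - S n 0) / \<mu> * U (P \<mu>) + V (P \<mu>))) / G (P \<mu>) (P \<mu>)
      = (deriv (S n) \<mu> - deriv (S n) 0) / (\<mu> - 0)"
    using ball' eventually_neq_at_within[of 0 0 UNIV]
      S_has_derivative[OF n, THEN filter_leD[OF at_within_le_nhds]]
  proof eventually_elim
    case (elim \<mu>)
    have "deriv (S n) \<mu> = - H (P \<mu>) (P \<mu>) / G (P \<mu>) (P \<mu>)"
      using DERIV_imp_deriv[OF elim(3)] by (simp add: P_def)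
    moreover have "(H (P \<mu>) (P \<mu>) - 2 * H (P \<mu>) p0) / \<mu> +
        2 * ((S n \<mu> - S n 0) / \<mu> * U (P \<mu>) + V (P \<mu>)) = H (P \<mu>) (P \<mu>) / \<mu>"
      unfolding H[OF elim(1)] using elim(2) by (simp add: field_simps)
    ultimately show ?case using deriv_S_0(2)[OF n H0] by simp
  qed
  ultimately have "((\<lambda>\<mu>. (deriv (S n) \<mu> - deriv (S n) 0) / (\<mu> - 0)) \<longlongrightarrow>
      - (0 + 2 * (0 * U p0 + V p0)) / G p0 p0) (at 0)"
    by (rule Lim_transform_eventually)
  then have "(deriv (S n) has_real_derivative D) (at 0)"
    by (simp add: has_field_derivative_iff D_def)
  then show "deriv (S n) field_differentiable (at 0)" "deriv (deriv (S n)) 0 > 0"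
    using V0 G_pos[of p0] by (auto simp: field_differentiable_def DERIV_imp_deriv D_def divide_less_0_iff)
qed

end

section \<open>The sinusoidal weight\<close>

lemma has_integral_sin_period:
  "((\<lambda>x. sin (2 * of_int j * pi * x)) has_integral 0) {0..1::real}"
proof (cases "j = 0")
  case False
  have "((\<lambda>x. sin (2 * of_int j * pi * x)) has_integral
      - cos (2 * of_int j * pi * 1) / (2 * of_int j * pi) - - cos (2 * of_int j * pi * 0) / (2 * of_int j * pi)) {0..1::real}"
    using False
    by (intro fundamental_theorem_of_calculus)
       (auto simp flip: has_real_derivative_iff_has_vector_derivative intro!: derivative_eq_intros)
  then show ?thesis using cos_int_2pin[of j] by (simp add: mult_ac)
qed simp

lemma has_integral_cos_period:
  "((\<lambda>x. cos (2 * of_int j * pi * x)) has_integral of_bool (j = 0)) {0..1::real}"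
proof (cases "j = 0")
  case False
  have "((\<lambda>x. cos (2 * of_int j * pi * x)) has_integral
      sin (2 * of_int j * pi * 1) / (2 * of_int j * pi) - sin (2 * of_int j * pi * 0) / (2 * of_int j * pi)) {0..1::real}"
    using False
    by (intro fundamental_theorem_of_calculus)
       (auto simp flip: has_real_derivative_iff_has_vector_derivative intro!: derivative_eq_intros)
  then show ?thesis using False sin_int_2pin[of j] by (simp add: mult_ac)
qed (use has_integral_const_real[of "1::real" 0 1] in simp)

text \<open>Product-to-sum formula. The half-sum and half-difference of the frequencies must be
  integers, as they are for frequencies of equal parity; a zero one contributes the integral of a
  constant.\<close>

lemma has_integral_cos_cos:
  assumes "a + b = 2 * of_int s" "a - b = 2 * of_int d"
  shows "((\<lambda>x. cos (a * pi * x) * cos (b * pi * x)) has_integral (of_bool (s = 0) + of_bool (d = 0)) / 2) {0..1::real}"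
proof -
  have "cos (a * pi * x) * cos (b * pi * x) = (cos (2 * of_int s * pi * x) + cos (2 * of_int d * pi * x)) / 2" for x
    unfolding assms[symmetric] by (simp add: cos_times_cos algebra_simps)
  then show ?thesis
    by (simp only:) (intro has_integral_divide has_integral_add has_integral_cos_period)
qed

text \<open>Linearising the square and the product leaves only sines over full periods. This makes
  the first derivative of each eigenvalue vanish at 0.\<close>

lemma integral_sin_sin_squared:
  fixes k n :: int
  shows "((\<lambda>x. sin (2 * of_int k * pi * x) * (sin (of_int n * pi * x))\<^sup>2) has_integral 0) {0..1::real}"
proof -
  have eq: "sin (2 * of_int k * pi * x) * (sin (of_int n * pi * x))\<^sup>2 =
      sin (2 * of_int k * pi * x) / 2 - (sin (2 * of_int (k + n) * pi * x) / 4 + sin (2 * of_int (k - n) * pi * x) / 4)" for x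
  proof -
    let ?a = "2 * of_int k * pi * x" and ?b = "of_int n * pi * x"
    have "sin (2 * of_int (k + n) * pi * x) = sin (?a + 2 * ?b)"
      "sin (2 * of_int (k - n) * pi * x) = sin (?a - 2 * ?b)" by (simp_all add: algebra_simps)
    then show ?thesis unfolding sin_add sin_diff cos_double_sin by (simp add: field_simps)
  qed
  have "((\<lambda>x. sin (2 * of_int k * pi * x) / 2 - (sin (2 * of_int (k + n) * pi * x) / 4 + sin (2 * of_int (k - n) * pi * x) / 4))
      has_integral 0 / 2 - (0 / 4 + 0 / 4)) {0..1::real}"
    by (intro has_integral_diff has_integral_add has_integral_divide has_integral_sin_period)
  then show ?thesis unfolding eq by simp
qed

section \<open>The explicit first-order response for the sine weight\<close>

theorem theorem2p1:
  fixes k :: nat and m :: "real \<Rightarrow> real" and \<Sigma> :: "nat \<Rightarrow> real \<Rightarrow> real"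
  assumes "k \<ge> 1"
    and "\<And>x. x \<in> {0..1} \<Longrightarrow> m x = sin (2 * real k * pi * x)"
    and "\<And>n \<mu>. n \<ge> 1 \<Longrightarrow> \<Sigma> n \<mu> = nth_dirichlet_eigenvalue m n \<mu>"
  shows "(\<forall>n\<ge>1. (\<forall>\<^sub>F \<mu> in nhds 0. \<Sigma> n field_differentiable (at \<mu>)) \<and> deriv (\<Sigma> n) 0 = 0) \<and>
         (\<forall>n\<ge>k+1.
            deriv (\<Sigma> n) field_differentiable (at 0) \<and>
            deriv (deriv (\<Sigma> n)) 0 > 0 \<and>
            (\<forall>\<^sub>F \<mu> in nhds 0. \<Sigma> n 0 \<le> \<Sigma> n \<mu>) \<and>
            \<not> concave_on UNIV (\<Sigma> n))"
proof -
  note m = assms(2)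
  interpret sturm_liouville m
  proof
    have "continuous_on {0..1} (\<lambda>x. sin (2 * real k * pi * x))" by (intro continuous_intros)
    then show "continuous_on {0..1} m" by (rule continuous_on_eq) (simp add: m)
  qed (simp add: m)
  have \<Sigma>: "\<Sigma> n = S n" if "n \<ge> 1" for n using assms(3)[OF that] by auto
  have Y0: "Y (e n, 0) x = sin (real n * pi * x) / (real n * pi)" if "n \<ge> 1" "x \<in> {0..1}" for n x
    unfolding e_def by (rule Y_free) (use that in auto)
  have H0: "H (e n, 0) (e n, 0) = 0" if n: "n \<ge> 1" for n
  proof -
    have "((\<lambda>x. sin (2 * of_int (int k) * pi * x) * (sin (of_int (int n) * pi * x))\<^sup>2 / (real n * pi)\<^sup>2)
        has_integral 0 / (real n * pi)\<^sup>2) {0..1::real}"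
      by (intro has_integral_divide integral_sin_sin_squared)
    then have "((\<lambda>x. m x * Y (e n, 0) x * Y (e n, 0) x) has_integral 0 / (real n * pi)\<^sup>2) {0..1}"
      by (rule has_integral_eq[rotated]) (simp add: m Y0[OF n] power2_eq_square)
    then show ?thesis unfolding H_def by (simp add: integral_unique)
  qed
  have second: "deriv (S n) field_differentiable (at 0) \<and> deriv (deriv (S n)) 0 > 0 \<and>
      (\<forall>\<^sub>F \<mu> in nhds 0. S n 0 \<le> S n \<mu>) \<and> \<not> concave_on UNIV (S n)" if n: "n \<ge> k + 1" for n
  proof -
    have n1: "n \<ge> 1" using n by simp
    define K where "K = real k"
    define N where "N = real n"
    have KN: "K \<ge> 1" "N > K" using n assms(1) by (auto simp: K_def N_def)
    \<comment> \<open>Undetermined coefficients: \<open>m * Y (e n, 0)\<close> is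
      \<open>(cos ((2K - N) pi x) - cos ((2K + N) pi x)) / (2 N pi)\<close>, and
      \<open>(2K - N)^2 - N^2 = 4K (K - N)\<close>, \<open>(2K + N)^2 - N^2 = 4K (K + N)\<close>
      give \<open>A\<close> and \<open>B\<close>. \<open>C\<close> is the coefficient of the
      homogeneous solution that makes \<open>u 0 = 0\<close>.\<close>
    define c where "c = 1 / (8 * N * K * pi ^ 3)"
    define A where "A = c / (K - N)"
    define B where "B = c / (K + N)"
    define C where "C = c * (2 * N) / (K\<^sup>2 - N\<^sup>2)"
    have c: "c > 0" using KN by (simp add: c_def)
    have nz: "K - N \<noteq> 0" "K + N \<noteq> 0" "N \<noteq> 0" "K \<noteq> 0" using KN by auto
    have KN2: "K\<^sup>2 - N\<^sup>2 = (K - N) * (K + N)" by (simp add: power2_eq_square algebra_simps)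
    have ABC: "A - B = C" unfolding A_def B_def C_def KN2 using nz by (simp add: field_simps)
    have cc: "c * (4 * K * pi\<^sup>2) = 1 / (2 * N * pi)"
      unfolding c_def using nz by (simp add: field_simps power2_eq_square power3_eq_cube)
    have A': "A * ((2 * K - N) * pi)\<^sup>2 = A * (N * pi)\<^sup>2 + 1 / (2 * N * pi)"
    proof -
      have "A * ((2 * K - N) * pi)\<^sup>2 - A * (N * pi)\<^sup>2 = (A * (K - N)) * (4 * K * pi\<^sup>2)"
        by (simp add: power2_eq_square algebra_simps)
      also have "A * (K - N) = c" using nz by (simp add: A_def)
      finally show ?thesis using cc by simp
    qed
    have B': "B * ((2 * K + N) * pi)\<^sup>2 = B * (N * pi)\<^sup>2 + 1 / (2 * N * pi)"
    proof -
      have "B * ((2 * K + N) * pi)\<^sup>2 - B * (N * pi)\<^sup>2 = (B * (K + N)) * (4 * K * pi\<^sup>2)"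
        by (simp add: power2_eq_square algebra_simps)
      also have "B * (K + N) = c" using nz by (simp add: B_def)
      finally show ?thesis using cc by simp
    qed
    let ?c1 = "\<lambda>x. cos ((2 * K - N) * pi * x)" and ?c2 = "\<lambda>x. cos ((2 * K + N) * pi * x)"
      and ?c3 = "\<lambda>x. cos (N * pi * x)"
    define u where "u x = A * ?c1 x - B * ?c2 x - C * ?c3 x" for x
    define u' where "u' x = - (A * ((2 * K - N) * pi) * sin ((2 * K - N) * pi * x))
      + B * ((2 * K + N) * pi) * sin ((2 * K + N) * pi * x) + C * (N * pi) * sin (N * pi * x)" for x
    have mY: "m x * Y (e n, 0) x = (?c1 x - ?c2 x) / (2 * N * pi)" if "x \<in> {0..1}" for x
    proof -
      have eq: "sin (2 * K * pi * x) * sin (N * pi * x) = (?c1 x - ?c2 x) / 2"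
        unfolding sin_times_sin by (simp add: left_diff_distrib distrib_right)
      have "m x * Y (e n, 0) x = sin (2 * K * pi * x) * sin (N * pi * x) / (N * pi)"
        using that by (simp add: m Y0[OF n1] K_def N_def)
      then show ?thesis unfolding eq by simp
    qed
    have du: "(u has_real_derivative u' x) (at x within {0..1})" for x
      unfolding u_def u'_def by (auto intro!: derivative_eq_intros)
    have du': "(u' has_real_derivative - (e n * u x + m x * Y (e n, 0) x)) (at x within {0..1})"
      if x: "x \<in> {0..1}" for x
    proof -
      have "(u' has_real_derivative - (A * ((2 * K - N) * pi)\<^sup>2) * ?c1 x + (B * ((2 * K + N) * pi)\<^sup>2) * ?c2 x
          + C * (N * pi)\<^sup>2 * ?c3 x) (at x within {0..1})"
        unfolding u'_def by (auto intro!: derivative_eq_intros simp: power2_eq_square)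
      moreover have "- (A * ((2 * K - N) * pi)\<^sup>2) * ?c1 x + (B * ((2 * K + N) * pi)\<^sup>2) * ?c2 x
          + C * (N * pi)\<^sup>2 * ?c3 x = - (e n * u x + m x * Y (e n, 0) x)"
        unfolding A' B' mY[OF x] u_def unfolding e_def N_def[symmetric] by (simp add: algebra_simps diff_divide_distrib)
      ultimately show ?thesis by simp
    qed
    have u01: "u 0 = 0" "u 1 = 0"
    proof -
      have 1: "cos (2 * K * pi) = 1" "sin (2 * K * pi) = 0"
        using cos_int_2pin[of "int k"] sin_int_2pin[of "int k"] by (simp_all add: K_def mult_ac)
      \<comment> \<open>At 1 the frequencies differ by the full turn \<open>2 * K * pi\<close>, so
        \<open>u 1\<close> is \<open>A - B - C = 0\<close> times
        \<open>cos (N * pi)\<close>.\<close>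
      have "?c1 1 = ?c3 1" "?c2 1 = ?c3 1"
        by (simp_all add: left_diff_distrib distrib_right cos_diff cos_add 1)
      then show "u 0 = 0" "u 1 = 0" using ABC unfolding u_def by (auto simp flip: ABC simp: algebra_simps)
    qed
    \<comment> \<open>Expansion of \<open>u * (?c1 - ?c2)\<close> into products of cosines. The
      indicator of \<open>2 * k = n\<close> stays, since this case can occur and makes
      \<open>?c1\<close> constant; the other resonances are decided by
      \<open>1 \<le> k < n\<close>.\<close>
    have lin: "((\<lambda>x. (A * (?c1 x * ?c1 x) - (A + B) * (?c1 x * ?c2 x) - C * (?c1 x * ?c3 x)
         + B * (?c2 x * ?c2 x) + C * (?c2 x * ?c3 x)) / (2 * N * pi)) has_integral
       (A * ((of_bool (2 * int k - int n = 0) + of_bool ((0::int) = 0)) / 2)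
        - (A + B) * ((of_bool (2 * int k = 0) + of_bool (- int n = 0)) / 2)
        - C * ((of_bool (int k = 0) + of_bool (int k - int n = 0)) / 2)
        + B * ((of_bool (2 * int k + int n = 0) + of_bool ((0::int) = 0)) / 2)
        + C * ((of_bool (int k + int n = 0) + of_bool (int k = 0)) / 2)) / (2 * N * pi)) {0..1}"
      by (intro has_integral_divide has_integral_add has_integral_diff has_integral_mult_right has_integral_cos_cos)
         (simp_all add: K_def N_def)
    have eq: "(A * (?c1 x * ?c1 x) - (A + B) * (?c1 x * ?c2 x) - C * (?c1 x * ?c3 x)
         + B * (?c2 x * ?c2 x) + C * (?c2 x * ?c3 x)) / (2 * N * pi) = m x * u x * Y (e n, 0) x"
      if "x \<in> {0..1}" for x
    proof -
      have "A * (?c1 x * ?c1 x) - (A + B) * (?c1 x * ?c2 x) - C * (?c1 x * ?c3 x)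
         + B * (?c2 x * ?c2 x) + C * (?c2 x * ?c3 x) = u x * (?c1 x - ?c2 x)"
        by (simp add: u_def algebra_simps)
      also have "\<dots> / (2 * N * pi) = u x * (m x * Y (e n, 0) x)" by (simp add: mY[OF that])
      finally show ?thesis by (simp only: mult_ac)
    qed
    have "integral {0..1} (\<lambda>x. m x * u x * Y (e n, 0) x) =
       (A * ((of_bool (2 * int k - int n = 0) + 1) / 2) + B / 2) / (2 * N * pi)"
      using assms(1) n integral_unique[OF has_integral_eq[OF eq lin]] by (auto simp: add_eq_0_iff)
    \<comment> \<open>For \<open>n > k\<close> the coefficient \<open>A = - c / (N - K)\<close> is
      negative and outweighs \<open>B = c / (N + K)\<close>; the case \<open>2 * k = n\<close> only
      doubles the negative term.\<close>
    moreover have "A * ((of_bool (2 * int k - int n = 0) + 1) / 2) + B / 2 < 0"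
    proof -
      have "A < 0" using c KN by (simp add: A_def divide_pos_neg)
      then have "A * ((of_bool (2 * int k - int n = 0) + 1) / 2) \<le> A / 2" by simp
      moreover have "B < c / (N - K)"
        unfolding B_def using c KN by (intro divide_strict_left_mono) auto
      moreover have "A = - (c / (N - K))"
        using minus_divide_right[of c "N - K"] by (simp add: A_def)
      ultimately show ?thesis by linarith
    qed
    ultimately have "integral {0..1} (\<lambda>x. m x * u x * Y (e n, 0) x) < 0"
      using KN by (simp add: divide_neg_pos)
    from second_order_perturbation[OF n1 H0[OF n1] du du' u01 this] show ?thesis by blast
  qed
  show ?thesis using deriv_S_0[OF _ H0] second \<Sigma> by auto
qed

end
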